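(* Let $D$ be a finite simple digraph on $\{z_1,\dots,z_m\}$ and let $G=G(D)$ be its associated bipartite graph, with edges $f_1,\dots,f_r$. Let $\phi$ be the presentation matrix of the edge ideal $I=I(G)$ that results from its Taylor resolution, and let $\overline{B(\phi)}$ be its reduced Jacobian dual. Then the directed cycles of length $t$ in $D$ correspond exactly to the binomial $t\times t$ minors of $\overline{B(\phi)}$ that satisfy the following conditions: (1) the columns (of the corresponding $t\times t$ submatrix) are pairwise center-distinct; (2) their monomials are square-free and relatively prime; and (3) one of these monomials is the product of variables that correspond to a subset of the perfect matching $M_D$. Here the correspondence associates to a directed cycle $z_{i_1}\to z_{i_2}\to\cdots\to z_{i_t}\to z_{i_1}$ the binomial (up to sign) given by the difference of the product of the variables $T_a$ corresponding to the edges $\{x_{i_j},y_{i_j}\}$, $j=1,\dots,t$, and the product of the variables $T_b$ corresponding to the edges $\{x_{i_j},y_{i_{j+1}}\}$, $j=1,\dots,t$ (with $i_{t+1}=i_1$). That is: the binomial of every directed cycle of length $t$ is, up to sign, such a minor, and every such minor is, up to sign, the binomial of a directed cycle of length $t$ in $D$.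
   Context: A digraph $D=(Z,\vec E)$ consists of a vertex set $Z=\{z_1,\dots,z_m\}$ and a set $\vec E$ of ordered pairs of vertices (directed edges $z_i\to z_j$); simple means no loops and no multiple edges. A directed cycle of length $t$ is a closed directed walk $z_{i_1}\to z_{i_2}\to\cdots\to z_{i_t}\to z_{i_1}$ with distinct vertices $z_{i_1},\dots,z_{i_t}$. The bipartite graph $G(D)$ has vertices $x_1,\dots,x_m,y_1,\dots,y_m$ and edges $\{x_i,y_i\}$ for all $i$, and $\{x_i,y_j\}$ for $i\neq j$ whenever $z_i\to z_j$ is in $\vec E$. Its perfect matching $M_D$ is $\{\{x_i,y_i\} : i=1,\dots,m\}$. $\Bbbk$ is an infinite field, $R$ is the polynomial ring over $\Bbbk$ in the vertices $x_1,\dots,x_m,y_1,\dots,y_m$ of $G$, and $\mathfrak m$ is the ideal generated by all these variables. An edge between vertices $u$ and $v$ is identified with the monomial $uv$, and the edge ideal $I(G)$ is generated by the edges $f_1,\dots,f_r$. New variables $T_1,\dots,T_r$ are introduced, $T_i$ corresponding to $f_i$. Taylor presentation matrix: $\phi$ has rows indexed by $f_1,\dots,f_r$ and columns indexed by the 2-element subsets $\tau$ of $\{f_1,\dots,f_r\}$; the column of $\tau=\{f_j,f_k\}$, $j<k$, has entry $-\operatorname{lcm}(f_j,f_k)/f_j$ in row $f_j$, entry $\operatorname{lcm}(f_j,f_k)/f_k$ in row $f_k$, and $0$ elsewhere. Jacobian dual: $B(\phi)$ is a matrix with entries in $R[T_1,\dots,T_r]$, linear in $T_1,\dots,T_r$,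 with $[T_1\ \cdots\ T_r]\cdot\phi=[x_1\ \cdots\ x_m\ y_1\ \cdots\ y_m]\cdot B(\phi)$. The reduced Jacobian dual $\overline{B(\phi)}=B(\phi)\otimes R/\mathfrak m$ is obtained by reducing the entries modulo $\mathfrak m$; it does not depend on the choice of $B(\phi)$. Its nonzero columns come from pairs of edges $f_j,f_k$ sharing a vertex, i.e. from paths of length 2 in $G$. Two nonzero columns of $\overline{B(\phi)}$ are center-distinct if the corresponding paths of length 2 have distinct middle vertices (the middle vertex of the path with edges $f_j,f_k$ is their common vertex). A $t\times t$ minor is the determinant of a $t\times t$ submatrix; it is binomial if it can be written as the sum or difference of two monomials. *)

theory Defs
  imports
    "HOL-Library.Poly_Mapping"
    "Graph_Theory.Pair_Digraph"
    "Jordan_Normal_Form.Determinant"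
    "Jordan_Normal_Form.DL_Submatrix"
begin

section \<open>Multivariate polynomials\<close>

text \<open>
  \<open>('v, 'k) mpoly\<close> is the polynomial ring over \<open>'k\<close> with one variable for every element of the
  type \<open>'v\<close>; a monomial is represented by its exponent vector \<open>'v \<Rightarrow>\<^sub>0 nat\<close>.
  The polynomial ring on a smaller set \<open>V\<close> of variables is the subring \<open>mpoly_ring V\<close>.
\<close>

type_synonym ('v, 'k) mpoly = "('v \<Rightarrow>\<^sub>0 nat) \<Rightarrow>\<^sub>0 'k"

abbreviation mono_poly :: "('v \<Rightarrow>\<^sub>0 nat) \<Rightarrow> ('v, 'k::comm_ring_1) mpoly" where
  "mono_poly \<mu> \<equiv> Poly_Mapping.single \<mu> 1"

abbreviation Const :: "'k \<Rightarrow> ('v, 'k::comm_ring_1) mpoly" where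
  "Const c \<equiv> Poly_Mapping.single 0 c"

abbreviation Var :: "'v \<Rightarrow> ('v, 'k::comm_ring_1) mpoly" where
  "Var v \<equiv> mono_poly (Poly_Mapping.single v 1)"

abbreviation const_coeff :: "('v, 'k::comm_ring_1) mpoly \<Rightarrow> 'k" where
  "const_coeff p \<equiv> Poly_Mapping.lookup p 0"

definition mpoly_ring :: "'v set \<Rightarrow> ('v, 'k::comm_ring_1) mpoly set" where
  "mpoly_ring V = {p. \<forall>\<mu>\<in>Poly_Mapping.keys p. Poly_Mapping.keys \<mu> \<subseteq> V}"

lift_definition lcm_exp :: "('v \<Rightarrow>\<^sub>0 nat) \<Rightarrow> ('v \<Rightarrow>\<^sub>0 nat) \<Rightarrow> ('v \<Rightarrow>\<^sub>0 nat)" is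
  "\<lambda>\<mu> \<nu> v. max (\<mu> v) (\<nu> v)"
proof -
  fix \<mu> \<nu> :: "'v \<Rightarrow> nat"
  assume "finite {v. \<mu> v \<noteq> 0}" "finite {v. \<nu> v \<noteq> 0}"
  then have "finite ({v. \<mu> v \<noteq> 0} \<union> {v. \<nu> v \<noteq> 0})" by simp
  then show "finite {v. max (\<mu> v) (\<nu> v) \<noteq> 0}"
    by (rule rev_finite_subset) (auto simp: max_def)
qed

definition squarefree_exp :: "('v \<Rightarrow>\<^sub>0 nat) \<Rightarrow> bool" where
  "squarefree_exp \<mu> \<longleftrightarrow> (\<forall>v. Poly_Mapping.lookup \<mu> v \<le> 1)"

definition coprime_exp :: "('v \<Rightarrow>\<^sub>0 nat) \<Rightarrow> ('v \<Rightarrow>\<^sub>0 nat) \<Rightarrow> bool" where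
  "coprime_exp \<mu> \<nu> \<longleftrightarrow> Poly_Mapping.keys \<mu> \<inter> Poly_Mapping.keys \<nu> = {}"


section \<open>The bipartite graph of a digraph\<close>

datatype 'a bvert = X 'a | Y 'a

definition bip_matching :: "'a pair_pre_digraph \<Rightarrow> 'a bvert set set" where
  "bip_matching D = {{X z, Y z} | z. z \<in> pverts D}"

definition bip_edges :: "'a pair_pre_digraph \<Rightarrow> 'a bvert set set" where
  "bip_edges D = bip_matching D \<union> {{X z, Y w} | z w. z \<noteq> w \<and> (z, w) \<in> parcs D}"

definition enumerates :: "'b list \<Rightarrow> 'b set \<Rightarrow> bool" where
  "enumerates xs A \<longleftrightarrow> distinct xs \<and> set xs = A"

text \<open>
  Throughout, \<open>zs\<close> enumerates the vertices of the digraph and \<open>fs\<close> the edges of the bipartite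
  graph (with indices starting at 0), and \<open>prs\<close> enumerates the two-element sets of edges,
  \<open>(j, k)\<close> with \<open>j < k\<close> standing for \<open>{fs ! j, fs ! k}\<close>.
\<close>

definition bip_vars :: "'a list \<Rightarrow> 'a bvert list" where
  "bip_vars zs = map X zs @ map Y zs"

definition pair_indices :: "nat \<Rightarrow> (nat \<times> nat) set" where
  "pair_indices r = {(j, k). j < k \<and> k < r}"

definition edge_exp :: "'v set \<Rightarrow> ('v \<Rightarrow>\<^sub>0 nat)" where
  "edge_exp e = (\<Sum>v\<in>e. Poly_Mapping.single v 1)"


section \<open>Taylor presentation matrix and Jacobian dual\<close>

definition taylor_matrix ::
  "'v set list \<Rightarrow> (nat \<times> nat) list \<Rightarrow> ('v, 'k::comm_ring_1) mpoly mat" where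
  "taylor_matrix fs prs = mat (length fs) (length prs) (\<lambda>(i, c).
     let (j, k) = prs ! c;
         l = lcm_exp (edge_exp (fs ! j)) (edge_exp (fs ! k))
     in if i = j then - mono_poly (l - edge_exp (fs ! j))
        else if i = k then mono_poly (l - edge_exp (fs ! k))
        else 0)"

text \<open>
  \<open>R[T\<^sub>0, \<dots>, T\<^sub>r\<^sub>-\<^sub>1]\<close> consists of polynomials in the variables \<open>T\<^sub>i\<close> (\<open>i :: nat\<close>) whose coefficients
  are themselves polynomials in the vertices.
\<close>

definition linear_in_T :: "'v set \<Rightarrow> nat \<Rightarrow> (nat, ('v, 'k::comm_ring_1) mpoly) mpoly \<Rightarrow> bool" where
  "linear_in_T V r p \<longleftrightarrow>
     (\<forall>\<mu>\<in>Poly_Mapping.keys p. (\<exists>i<r. \<mu> = Poly_Mapping.single i 1) \<and>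
        Poly_Mapping.lookup p \<mu> \<in> mpoly_ring V)"

definition row_matrix :: "'b list \<Rightarrow> 'b mat" where
  "row_matrix xs = mat_of_rows_list (length xs) [xs]"

definition jacobian_dual ::
  "'v list \<Rightarrow> ('v, 'k::comm_ring_1) mpoly mat \<Rightarrow> (nat, ('v, 'k) mpoly) mpoly mat \<Rightarrow> bool" where
  "jacobian_dual vs \<phi> B \<longleftrightarrow>
     B \<in> carrier_mat (length vs) (dim_col \<phi>) \<and>
     (\<forall>i<dim_row B. \<forall>c<dim_col B. linear_in_T (set vs) (dim_row \<phi>) (B $$ (i, c))) \<and>
     row_matrix (map Var [0..<dim_row \<phi>]) * map_mat Const \<phi> =
       row_matrix (map (\<lambda>v. Const (Var v)) vs) * B"

text \<open>
  Reduction modulo the ideal generated by all vertices: \<open>R / m\<close> is identified with \<open>'k\<close> via the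
  constant coefficient, so the reduced entries lie in \<open>k[T\<^sub>0, \<dots>, T\<^sub>r\<^sub>-\<^sub>1]\<close>. See the lemmas
  \<open>const_coeff_eq_0_iff\<close> and \<open>const_coeff_mult\<close> below.
\<close>

definition reduce_mod_vars ::
  "(nat, ('v, 'k::comm_ring_1) mpoly) mpoly mat \<Rightarrow> (nat, 'k) mpoly mat" where
  "reduce_mod_vars B = map_mat (Poly_Mapping.map const_coeff) B"


section \<open>Minors and cycle binomials\<close>

definition path_center :: "'v set list \<Rightarrow> nat \<times> nat \<Rightarrow> 'v" where
  "path_center fs = (\<lambda>(j, k). THE v. v \<in> fs ! j \<inter> fs ! k)"

definition center_distinct ::
  "'v set list \<Rightarrow> (nat \<times> nat) list \<Rightarrow> 'b::zero mat \<Rightarrow> nat \<Rightarrow> nat \<Rightarrow> bool" where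
  "center_distinct fs prs A c d \<longleftrightarrow>
     col A c \<noteq> 0\<^sub>v (dim_row A) \<and> col A d \<noteq> 0\<^sub>v (dim_row A) \<and>
     path_center fs (prs ! c) \<noteq> path_center fs (prs ! d)"

definition T_of :: "'v set list \<Rightarrow> 'v set \<Rightarrow> (nat, 'k::comm_ring_1) mpoly" where
  "T_of fs e = Var (THE i. i < length fs \<and> fs ! i = e)"

text \<open>
  The two monomials of a binomial are required to be different; otherwise the zero polynomial
  would be a binomial with coprime square-free monomials, being \<open>1 - 1\<close>.
\<close>

definition cycle_minor ::
  "'a pair_pre_digraph \<Rightarrow> 'a bvert set list \<Rightarrow> (nat \<times> nat) list \<Rightarrow>
    (nat, 'k::comm_ring_1) mpoly mat \<Rightarrow> nat \<Rightarrow> (nat, 'k) mpoly \<Rightarrow> bool" where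
  "cycle_minor D fs prs A t q \<longleftrightarrow>
     (\<exists>I J. I \<subseteq> {..<dim_row A} \<and> J \<subseteq> {..<dim_col A} \<and> card I = t \<and> card J = t \<and>
        q = det (submatrix A I J) \<and>
        pairwise (center_distinct fs prs A) J \<and>
        (\<exists>\<mu> \<nu>. \<mu> \<noteq> \<nu> \<and>
           (q = mono_poly \<mu> + mono_poly \<nu> \<or> q = mono_poly \<mu> - mono_poly \<nu>) \<and>
           squarefree_exp \<mu> \<and> squarefree_exp \<nu> \<and> coprime_exp \<mu> \<nu> \<and>
           (\<exists>N\<subseteq>bip_matching D. mono_poly \<mu> = (\<Prod>e\<in>N. T_of fs e :: (nat, 'k) mpoly) \<or>
              mono_poly \<nu> = (\<Prod>e\<in>N. T_of fs e :: (nat, 'k) mpoly))))"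

text \<open>A directed cycle is given by the list \<open>p\<close> of its arcs \<open>(z, w)\<close>, in order.\<close>

definition cycle_binomial :: "'a bvert set list \<Rightarrow> ('a \<times> 'a) list \<Rightarrow> (nat, 'k::comm_ring_1) mpoly" where
  "cycle_binomial fs p =
     (\<Prod>(z, w)\<leftarrow>p. T_of fs {X z, Y z}) - (\<Prod>(z, w)\<leftarrow>p. T_of fs {X z, Y w})"


section \<open>The reduction is well defined and Jacobian duals exist\<close>

lemma poly_mapping_sum_single:
  fixes p :: "'b \<Rightarrow>\<^sub>0 'k::comm_monoid_add"
  shows "p = (\<Sum>\<mu>\<in>Poly_Mapping.keys p. Poly_Mapping.single \<mu> (Poly_Mapping.lookup p \<mu>))"
proof (rule poly_mapping_eqI)
  fix k
  show "Poly_Mapping.lookup p k = Poly_Mapping.lookup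
    (\<Sum>\<mu>\<in>Poly_Mapping.keys p. Poly_Mapping.single \<mu> (Poly_Mapping.lookup p \<mu>)) k"
    by (simp add: lookup_sum lookup_single when_def sum.delta in_keys_iff)
qed

lemma const_coeff_Var_mult:
  fixes q :: "('v, 'k::comm_ring_1) mpoly"
  shows "const_coeff (Var v * q) = 0"
proof -
  have "Poly_Mapping.keys (Var v * q) \<subseteq> {a + b | a b. a \<in> Poly_Mapping.keys (Var v :: ('v, 'k) mpoly) \<and> b \<in> Poly_Mapping.keys q}"
    by (rule keys_mult)
  moreover have "Poly_Mapping.single v (1::nat) + b \<noteq> 0" for b
  proof
    assume "Poly_Mapping.single v (1::nat) + b = 0"
    then have "Poly_Mapping.lookup (Poly_Mapping.single v (1::nat) + b) v = 0" by simp
    then show False by (simp add: lookup_add)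
  qed
  ultimately have "0 \<notin> Poly_Mapping.keys (Var v * q)" by fastforce
  then show ?thesis by (simp add: in_keys_iff)
qed

lemma const_coeff_eq_0_iff:
  fixes p :: "('v, 'k::comm_ring_1) mpoly"
  assumes V: "finite V" and p: "p \<in> mpoly_ring V"
  shows "const_coeff p = 0 \<longleftrightarrow> (\<exists>c. (\<forall>v\<in>V. c v \<in> mpoly_ring V) \<and> p = (\<Sum>v\<in>V. Var v * c v))"
proof
  assume "\<exists>c. (\<forall>v\<in>V. c v \<in> mpoly_ring V) \<and> p = (\<Sum>v\<in>V. Var v * c v)"
  then show "const_coeff p = 0"
    by (auto simp: lookup_sum const_coeff_Var_mult simp del: One_nat_def)
next
  assume p0: "const_coeff p = 0"
  define w where "w \<mu> = (SOME v. v \<in> Poly_Mapping.keys \<mu>)" for \<mu> :: "'v \<Rightarrow>\<^sub>0 nat"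
  have w: "w \<mu> \<in> Poly_Mapping.keys \<mu>" if "\<mu> \<in> Poly_Mapping.keys p" for \<mu>
  proof -
    have "\<mu> \<noteq> 0" using that p0 by (auto simp: in_keys_iff)
    then have "Poly_Mapping.keys \<mu> \<noteq> {}" by simp
    then show ?thesis unfolding w_def by (simp add: some_in_eq)
  qed
  define c where "c v = (\<Sum>\<mu>\<in>{\<mu>\<in>Poly_Mapping.keys p. w \<mu> = v}.
    Poly_Mapping.single (\<mu> - Poly_Mapping.single v 1) (Poly_Mapping.lookup p \<mu>))" for v
  have minus: "Poly_Mapping.single v 1 + (\<mu> - Poly_Mapping.single v 1) = \<mu>"
    if "v \<in> Poly_Mapping.keys \<mu>" for v and \<mu> :: "'v \<Rightarrow>\<^sub>0 nat"
    using that by (intro poly_mapping_eqI)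
      (auto simp: lookup_add lookup_minus lookup_single when_def in_keys_iff)
  have "Var v * c v = (\<Sum>\<mu>\<in>{\<mu>\<in>Poly_Mapping.keys p. w \<mu> = v}.
    Poly_Mapping.single \<mu> (Poly_Mapping.lookup p \<mu>))" for v
    unfolding c_def sum_distrib_left mult_single
    by (rule sum.cong) (use minus w in auto)
  then have "(\<Sum>v\<in>V. Var v * c v) = (\<Sum>v\<in>V. \<Sum>\<mu>\<in>{\<mu>\<in>Poly_Mapping.keys p. w \<mu> = v}.
    Poly_Mapping.single \<mu> (Poly_Mapping.lookup p \<mu>))" by simp
  also have "\<dots> = (\<Sum>\<mu>\<in>Poly_Mapping.keys p. Poly_Mapping.single \<mu> (Poly_Mapping.lookup p \<mu>))"
    using w p V by (intro sum.group) (auto simp: mpoly_ring_def)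
  also have "\<dots> = p" by (rule poly_mapping_sum_single[symmetric])
  finally have "p = (\<Sum>v\<in>V. Var v * c v)" by simp
  moreover have "c v \<in> mpoly_ring V" for v
  proof -
    have "Poly_Mapping.keys \<mu> \<subseteq> V" if "\<mu> \<in> Poly_Mapping.keys (c v)" for \<mu>
    proof -
      have "\<mu> \<in> (\<Union>\<nu>\<in>{\<nu>\<in>Poly_Mapping.keys p. w \<nu> = v}. Poly_Mapping.keys
          (Poly_Mapping.single (\<nu> - Poly_Mapping.single v 1) (Poly_Mapping.lookup p \<nu>)))"
        using that keys_sum unfolding c_def by fast
      then obtain \<nu> where "\<nu> \<in> Poly_Mapping.keys p" "\<mu> = \<nu> - Poly_Mapping.single v 1"
        by (auto split: if_splits)
      moreover have "Poly_Mapping.keys (\<nu> - Poly_Mapping.single v 1) \<subseteq> Poly_Mapping.keys \<nu>"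
        by (auto simp: in_keys_iff lookup_minus)
      ultimately show ?thesis using p by (auto simp: mpoly_ring_def)
    qed
    then show ?thesis by (auto simp: mpoly_ring_def)
  qed
  ultimately show "\<exists>c. (\<forall>v\<in>V. c v \<in> mpoly_ring V) \<and> p = (\<Sum>v\<in>V. Var v * c v)"
    by (intro exI[of _ c] conjI ballI)
qed


lemma const_coeff_mult: "const_coeff (p * q) = const_coeff p * const_coeff q"
  for p q :: "('v, 'k::comm_ring_1) mpoly"
proof -
  let ?r = "q - Const (const_coeff q)"
  let ?s = "p - Const (const_coeff p)"
  have *: "const_coeff (a * b) = 0" if "const_coeff b = 0" for a b :: "('v, 'k) mpoly"
  proof -
    let ?V = "\<Union>(Poly_Mapping.keys ` Poly_Mapping.keys b)"
    have "b \<in> mpoly_ring ?V" by (auto simp: mpoly_ring_def)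
    moreover have "finite ?V" by auto
    ultimately obtain c :: "'v \<Rightarrow> ('v, 'k) mpoly" where "b = (\<Sum>v\<in>?V. Var v * c v)"
      using const_coeff_eq_0_iff[of ?V b] \<open>const_coeff b = 0\<close> by blast
    then have "a * b = a * (\<Sum>v\<in>?V. Var v * c v)" by (rule arg_cong)
    also have "\<dots> = (\<Sum>v\<in>?V. Var v * (c v * a))"
      by (simp only: sum_distrib_left mult_ac)
    finally have "a * b = (\<Sum>v\<in>?V. Var v * (c v * a))" .
    then show ?thesis by (simp add: lookup_sum const_coeff_Var_mult del: One_nat_def)
  qed
  have "p * q = p * ?r + Const (const_coeff q) * ?s + Const (const_coeff p * const_coeff q)"
    by (simp add: algebra_simps mult_single)
  also have "const_coeff \<dots> = const_coeff p * const_coeff q"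
    by (simp add: lookup_add * lookup_minus)
  finally show ?thesis .
qed

lemma jacobian_dual_exists:
  fixes \<phi> :: "('v, 'k::comm_ring_1) mpoly mat"
  assumes "distinct vs"
    and \<phi>: "\<And>i c. i < dim_row \<phi> \<Longrightarrow> c < dim_col \<phi> \<Longrightarrow>
      \<phi> $$ (i, c) \<in> mpoly_ring (set vs) \<and> const_coeff (\<phi> $$ (i, c)) = 0"
  shows "\<exists>B. jacobian_dual vs \<phi> B"
proof -
  let ?r = "dim_row \<phi>" and ?n = "length vs"
  have "\<exists>g. (\<forall>v\<in>set vs. g v \<in> mpoly_ring (set vs)) \<and>
      \<phi> $$ (i, c) = (\<Sum>v\<in>set vs. Var v * g v)" if "i < ?r" "c < dim_col \<phi>" for i c
    using \<phi>[OF that] const_coeff_eq_0_iff[of "set vs"] by blast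
  then have ex: "\<forall>i c. \<exists>g. i < ?r \<and> c < dim_col \<phi> \<longrightarrow>
      (\<forall>v\<in>set vs. g v \<in> mpoly_ring (set vs)) \<and> \<phi> $$ (i, c) = (\<Sum>v\<in>set vs. Var v * g v)"
    by blast
  define g where "g i c = (SOME g. i < ?r \<and> c < dim_col \<phi> \<longrightarrow>
      (\<forall>v\<in>set vs. g v \<in> mpoly_ring (set vs)) \<and> \<phi> $$ (i, c) = (\<Sum>v\<in>set vs. Var v * g v))"
    for i c
  have "i < ?r \<and> c < dim_col \<phi> \<longrightarrow> (\<forall>v\<in>set vs. g i c v \<in> mpoly_ring (set vs)) \<and>
      \<phi> $$ (i, c) = (\<Sum>v\<in>set vs. Var v * g i c v)" for i c
    unfolding g_def using ex[THEN spec, THEN spec, of i c] by (rule someI_ex)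
  then have g: "\<And>i c v. i < ?r \<Longrightarrow> c < dim_col \<phi> \<Longrightarrow> v \<in> set vs \<Longrightarrow>
      g i c v \<in> mpoly_ring (set vs)"
    and g_eq: "\<And>i c. i < ?r \<Longrightarrow> c < dim_col \<phi> \<Longrightarrow> \<phi> $$ (i, c) = (\<Sum>v\<in>set vs. Var v * g i c v)"
    by blast+
  have nth_sum: "(\<Sum>v\<in>set vs. h v) = (\<Sum>a<?n. h (vs ! a))"
    for h :: "'v \<Rightarrow> ('v, 'k) mpoly"
    using sum.reindex_bij_betw[OF bij_betw_nth[OF \<open>distinct vs\<close> refl refl], of h] by simp
  define B where "B = mat ?n (dim_col \<phi>) (\<lambda>(a, c).
    \<Sum>i<?r. Poly_Mapping.single (Poly_Mapping.single i (1::nat)) (g i c (vs ! a)))"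
  have "linear_in_T (set vs) ?r (B $$ (a, c))" if "a < ?n" "c < dim_col \<phi>" for a c
    unfolding linear_in_T_def
  proof (intro ballI)
    fix \<mu> assume "\<mu> \<in> Poly_Mapping.keys (B $$ (a, c))"
    then have mu: "\<mu> \<in> Poly_Mapping.keys
        (\<Sum>i<?r. Poly_Mapping.single (Poly_Mapping.single i (1::nat)) (g i c (vs ! a)))"
      using that by (simp add: B_def)
    then have "\<mu> \<in> (\<Union>i\<in>{..<?r}. Poly_Mapping.keys
        (Poly_Mapping.single (Poly_Mapping.single i (1::nat)) (g i c (vs ! a))))"
      using keys_sum by fast
    then obtain i where i: "i < ?r" "\<mu> = Poly_Mapping.single i 1" by (auto split: if_splits)
    have inj: "Poly_Mapping.single x (1::nat) = Poly_Mapping.single y 1 \<longleftrightarrow> x = y" for x y :: nat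
      by (metis lookup_single_eq lookup_single_not_eq zero_neq_one)
    have "Poly_Mapping.lookup (B $$ (a, c)) \<mu> = g i c (vs ! a)"
      using that i by (simp add: B_def lookup_sum lookup_single when_def inj del: One_nat_def)
    then show "(\<exists>i<?r. \<mu> = Poly_Mapping.single i 1) \<and>
        Poly_Mapping.lookup (B $$ (a, c)) \<mu> \<in> mpoly_ring (set vs)"
      using i g that by auto
  qed
  moreover have "row_matrix (map Var [0..<?r]) * map_mat Const \<phi> =
      row_matrix (map (\<lambda>v. Const (Var v)) vs) * B" (is "?P = ?Q")
  proof (rule eq_matI)
    fix i c assume "i < dim_row ?Q" "c < dim_col ?Q"
    then have [simp]: "i = 0" and c: "c < dim_col \<phi>"
      by (auto simp: row_matrix_def mat_of_rows_list_def B_def)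
    have Const_sum: "Const (\<Sum>a\<in>A. h a) = (\<Sum>a\<in>A. Const (h a))"
      for h :: "nat \<Rightarrow> ('v, 'k) mpoly" and A
      by (induction A rule: infinite_finite_induct) (auto simp: single_add)
    have "?P $$ (i, c) = (\<Sum>j<?r. Var j * Const (\<phi> $$ (j, c)))"
      using c by (simp add: row_matrix_def mat_of_rows_list_def scalar_prod_def atLeast0LessThan
        del: One_nat_def)
    also have "\<dots> = (\<Sum>j<?r. \<Sum>a<?n. Const (Var (vs ! a)) *
        Poly_Mapping.single (Poly_Mapping.single j 1) (g j c (vs ! a)))"
      using c by (intro sum.cong refl)
        (simp add: g_eq nth_sum Const_sum sum_distrib_left mult_single del: One_nat_def)
    also have "\<dots> = (\<Sum>a<?n. Const (Var (vs ! a)) * B $$ (a, c))"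
      using c by (subst sum.swap) (simp add: B_def sum_distrib_left)
    also have "\<dots> = ?Q $$ (i, c)"
      using c by (simp add: row_matrix_def mat_of_rows_list_def scalar_prod_def atLeast0LessThan
        B_def del: One_nat_def)
    finally show "?P $$ (i, c) = ?Q $$ (i, c)" .
  qed (auto simp: row_matrix_def mat_of_rows_list_def B_def)
  moreover have "dim_row B = ?n" "dim_col B = dim_col \<phi>" by (auto simp: B_def)
  ultimately show ?thesis unfolding jacobian_dual_def by (intro exI[of _ B]) auto
qed

lemma lookup_edge_exp: "finite e \<Longrightarrow> Poly_Mapping.lookup (edge_exp e) v = of_bool (v \<in> e)"
  by (simp add: edge_exp_def lookup_sum lookup_single when_def sum.delta)

lemma jacobian_dual_taylor_exists:
  assumes D: "pair_digraph D" and zs: "enumerates zs (pverts D)"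
    and fs: "enumerates fs (bip_edges D)" and prs: "enumerates prs (pair_indices (length fs))"
  shows "\<exists>B. jacobian_dual (bip_vars zs)
    (taylor_matrix fs prs :: ('a bvert, 'k::comm_ring_1) mpoly mat) B"
proof (rule jacobian_dual_exists)
  interpret pair_digraph D by fact
  show "distinct (bip_vars zs)"
    using zs by (auto simp: bip_vars_def enumerates_def distinct_map inj_on_def)
  let ?\<phi> = "taylor_matrix fs prs :: ('a bvert, 'k) mpoly mat"
  fix i c assume "i < dim_row ?\<phi>" "c < dim_col ?\<phi>"
  then have i: "i < length fs" and c: "c < length prs" by (auto simp: taylor_matrix_def)
  obtain j k where jk: "prs ! c = (j, k)" by fastforce
  then have "(j, k) \<in> pair_indices (length fs)"
    using prs c nth_mem by (fastforce simp: enumerates_def)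
  then have jk': "j < length fs" "k < length fs" "j \<noteq> k" by (auto simp: pair_indices_def)
  have edge: "finite (fs ! l) \<and> card (fs ! l) = 2 \<and> fs ! l \<subseteq> set (bip_vars zs)"
    if "l < length fs" for l
  proof -
    have "fs ! l \<in> bip_edges D" using fs that nth_mem[of l fs] by (simp add: enumerates_def)
    then obtain z w where "fs ! l = {X z, Y w}" "z \<in> pverts D" "w \<in> pverts D"
      unfolding bip_edges_def bip_matching_def using wellformed' by blast
    then show ?thesis using zs by (simp add: bip_vars_def enumerates_def)
  qed
  have key: "(mono_poly \<mu> :: ('a bvert, 'k) mpoly) \<in> mpoly_ring (set (bip_vars zs)) \<and>
      const_coeff (mono_poly \<mu> :: ('a bvert, 'k) mpoly) = 0"
    if lm: "l < length fs" "m < length fs" "l \<noteq> m"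
      and mu: "\<And>v. Poly_Mapping.lookup \<mu> v = of_bool (v \<in> fs ! m \<and> v \<notin> fs ! l)" for l m \<mu>
  proof -
    have "fs ! l \<noteq> fs ! m" using fs lm by (simp add: enumerates_def nth_eq_iff_index_eq)
    then obtain v where "v \<in> fs ! m" "v \<notin> fs ! l"
      using edge lm by (metis card_subset_eq subsetI)
    then have "Poly_Mapping.lookup \<mu> v = 1" using mu by simp
    then have "\<mu> \<noteq> 0" by auto
    moreover have "Poly_Mapping.keys \<mu> \<subseteq> fs ! m" using mu by (auto simp: in_keys_iff)
    ultimately show ?thesis using edge lm by (auto simp: mpoly_ring_def lookup_single when_def)
  qed
  let ?l = "lcm_exp (edge_exp (fs ! j)) (edge_exp (fs ! k))"
  have 1: "Poly_Mapping.lookup (?l - edge_exp (fs ! j)) v = of_bool (v \<in> fs ! k \<and> v \<notin> fs ! j)"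
    and 2: "Poly_Mapping.lookup (?l - edge_exp (fs ! k)) v = of_bool (v \<in> fs ! j \<and> v \<notin> fs ! k)" for v
    using edge jk' by (auto simp: lookup_minus lcm_exp.rep_eq lookup_edge_exp)
  have "?\<phi> $$ (i, c) \<in> {- mono_poly (?l - edge_exp (fs ! j)), mono_poly (?l - edge_exp (fs ! k)), 0}"
    using i c jk by (simp add: taylor_matrix_def Let_def)
  then show "?\<phi> $$ (i, c) \<in> mpoly_ring (set (bip_vars zs)) \<and> const_coeff (?\<phi> $$ (i, c)) = 0"
    using key[OF jk'(1,2) jk'(3) 1] key[OF jk'(2,1) jk'(3)[symmetric] 2]
    by (auto simp: mpoly_ring_def in_keys_iff)
qed

end

theory Submission
  imports Defs "HOL-Combinatorics.Orbits"
begin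

text \<open>
  The column of the reduced Jacobian dual belonging to a path \<open>a - v - b\<close> has just two nonzero
  entries: up to opposite signs, the variable of \<open>{v, b}\<close> in row \<open>a\<close> and that of \<open>{v, a}\<close> in
  row \<open>b\<close>. Two coprime monomials of a minor therefore come from permutations \<open>\<sigma>\<close> and \<open>\<tau>\<close> that
  pick different entries in every column, and then both entries of every column lie in the minor.
  The terms of the determinant correspond to the sets \<open>C\<close> of columns with \<open>\<sigma> ` C = \<tau> ` C\<close>, so
  the minor is a binomial exactly if \<open>\<tau>\<^sup>-\<^sup>1 \<circ> \<sigma>\<close> is a single cycle. If one monomial consists of
  matching edges, the centers are all of the form \<open>x\<^sub>i\<close> or all of the form \<open>y\<^sub>i\<close>, and this cyclic
  permutation traces a directed cycle, forwards or backwards.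
\<close>

section \<open>Determinants with two nonzero entries in each column\<close>

text \<open>The exponent of a term that picks the variable with index \<open>h c\<close> in column
  \<open>c\<close>. Recording the choice function makes square-freeness an injectivity statement and
  coprimality a disjointness of images.\<close>

definition var_exp :: "(nat \<Rightarrow> nat) \<Rightarrow> nat \<Rightarrow> (nat \<Rightarrow>\<^sub>0 nat)" where
  "var_exp h n = (\<Sum>c<n. Poly_Mapping.single (h c) 1)"

lemma lookup_var_exp: "Poly_Mapping.lookup (var_exp h n) v = card {c\<in>{..<n}. h c = v}"
  by (simp add: var_exp_def lookup_sum lookup_single when_def flip: sum.inter_filter)

lemma keys_var_exp: "Poly_Mapping.keys (var_exp h n) = h ` {..<n}"
  by (auto simp: in_keys_iff lookup_var_exp)

lemma squarefree_var_exp_iff: "squarefree_exp (var_exp h n) \<longleftrightarrow> inj_on h {..<n}"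
proof -
  have "card {c\<in>{..<n}. h c = v} \<le> Suc 0 \<longleftrightarrow>
      (\<forall>a\<in>{..<n}. \<forall>b\<in>{..<n}. h a = v \<longrightarrow> h b = v \<longrightarrow> a = b)" for v
    by (subst card_le_Suc0_iff_eq) auto
  then show ?thesis
    by (simp only: squarefree_exp_def lookup_var_exp inj_on_def One_nat_def) blast
qed

lemma prod_single:
  fixes s :: "'c \<Rightarrow> 'k::comm_ring_1"
  shows "(\<Prod>c\<in>S. Poly_Mapping.single (h c) (s c)) = Poly_Mapping.single (\<Sum>c\<in>S. h c) (\<Prod>c\<in>S. s c)"
  by (induction S rule: infinite_finite_induct) (auto simp: mult_single)

lemma mono_poly_var_exp: "mono_poly (var_exp h n) = (\<Prod>c<n. Var (h c))"
  by (simp add: var_exp_def prod_single)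

lemma var_exp_cong: "(\<And>c. c < n \<Longrightarrow> h c = h' c) \<Longrightarrow> var_exp h n = var_exp h' n"
  by (simp add: var_exp_def)

text \<open>Each entry is a scalar times a single variable, so each Leibniz term is a scalar times a
  monomial. Zero entries fit the pattern with \<open>s r c = 0\<close> and an arbitrary
  variable.\<close>

lemma det_monomial_matrix:
  fixes A :: "(nat, 'k::comm_ring_1) mpoly mat"
  assumes A: "A \<in> carrier_mat t t"
    and entry: "\<And>r c. r < t \<Longrightarrow> c < t \<Longrightarrow>
      A $$ (r, c) = Poly_Mapping.single (Poly_Mapping.single (h r c) 1) (s r c)"
  shows "det A = (\<Sum>\<pi> | \<pi> permutes {0..<t}.
    Poly_Mapping.single (var_exp (\<lambda>c. h (\<pi> c) c) t) (signof \<pi> * (\<Prod>c<t. s (\<pi> c) c)))"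
proof -
  have "signof \<pi> * (\<Prod>c<t. A $$ (\<pi> c, c)) =
    Poly_Mapping.single (var_exp (\<lambda>c. h (\<pi> c) c) t) (signof \<pi> * (\<Prod>c<t. s (\<pi> c) c))"
    if "\<pi> permutes {0..<t}" for \<pi>
  proof -
    have "(\<Prod>c<t. A $$ (\<pi> c, c)) =
        (\<Prod>c<t. Poly_Mapping.single (Poly_Mapping.single (h (\<pi> c) c) 1) (s (\<pi> c) c))"
      using permutes_in_image[OF that] by (intro prod.cong refl entry) auto
    then show ?thesis
      by (simp add: prod_single var_exp_def sign_def del: One_nat_def flip: single_uminus)
  qed
  then show ?thesis unfolding det_col[OF A] by (intro sum.cong) auto
qed

section \<open>Permutations that mix two given permutations\<close>

text \<open>Outside \<open>C\<close> the permutation \<open>\<pi>\<close> agrees with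
  \<open>\<sigma>\<close>. As both are bijections of \<open>S\<close>, they then also have the same
  image on \<open>C\<close>, and there \<open>\<pi>\<close> is \<open>\<tau>\<close>.\<close>

lemma mixed_permutation_invariant:
  assumes "\<sigma> permutes S" "\<tau> permutes S" "\<pi> permutes S" "\<And>c. c \<in> S \<Longrightarrow> \<pi> c \<in> {\<sigma> c, \<tau> c}"
  defines "C \<equiv> {c\<in>S. \<pi> c = \<tau> c}"
  shows "\<sigma> ` C = \<tau> ` C"
proof -
  have compl: "p ` (S - C) = S - p ` C" if "p permutes S" for p
    using permutes_image[OF that] permutes_inj[OF that] by (simp add: image_set_diff)
  have sub: "p ` C \<subseteq> S" if "p permutes S" for p
    using permutes_image[OF that] C_def by auto
  have "\<pi> ` C = \<tau> ` C" by (auto simp: C_def image_iff)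
  moreover have "\<pi> ` (S - C) = \<sigma> ` (S - C)"
    using assms(4) by (intro image_cong) (auto simp: C_def)
  ultimately show ?thesis using compl sub assms(1-3) by (metis double_diff order_refl)
qed

text \<open>The converse of the previous lemma: injectivity could only fail by a clash between
  \<open>\<tau>\<close> on \<open>C\<close> and \<open>\<sigma>\<close> off \<open>C\<close>, and
  the equality of the images of \<open>C\<close> excludes this.\<close>

lemma permutes_mixed:
  assumes "\<sigma> permutes S" "\<tau> permutes S" "C \<subseteq> S" "\<sigma> ` C = \<tau> ` C"
  shows "(\<lambda>c :: 'a. if c \<in> C then \<tau> c else \<sigma> c) permutes S" (is "?\<pi> permutes S")
proof (rule bij_imp_permutes)
  have inj: "\<sigma> x = \<sigma> y \<longleftrightarrow> x = y" "\<tau> x = \<tau> y \<longleftrightarrow> x = y" for x y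
    using permutes_inj[OF assms(1)] permutes_inj[OF assms(2)] by (auto dest: injD)
  have cross: "\<tau> x \<noteq> \<sigma> y" if "x \<in> C" "y \<notin> C" for x y
  proof
    assume "\<tau> x = \<sigma> y"
    then have "\<sigma> y \<in> \<sigma> ` C" unfolding assms(4) using that(1) by (metis imageI)
    then show False using inj that(2) by auto
  qed
  have "inj_on ?\<pi> S"
  proof (rule inj_onI)
    fix x y assume "?\<pi> x = ?\<pi> y"
    then show "x = y" using inj cross[of x y] cross[of y x] by (cases "x \<in> C"; cases "y \<in> C") auto
  qed
  moreover have "?\<pi> ` S = S"
  proof -
    have split: "p ` S = p ` C \<union> p ` (S - C)" for p :: "'a \<Rightarrow> 'a" using assms(3) by blast
    have "?\<pi> ` S = ?\<pi> ` C \<union> ?\<pi> ` (S - C)" by (rule split)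
    also have "?\<pi> ` C = \<sigma> ` C" unfolding assms(4) by (rule image_cong) auto
    also have "?\<pi> ` (S - C) = \<sigma> ` (S - C)" by (rule image_cong) auto
    also have "\<sigma> ` C \<union> \<sigma> ` (S - C) = S" using split permutes_image[OF assms(1)] by metis
    finally show ?thesis .
  qed
  ultimately show "bij_betw ?\<pi> S S" by (simp add: bij_betw_def)
  show "\<And>x. x \<notin> S \<Longrightarrow> ?\<pi> x = x" using assms(1,3) by (auto simp: permutes_not_in)
qed

text \<open>A nonzero Leibniz term chooses between \<open>\<sigma> c\<close> and
  \<open>\<tau> c\<close> in every column and so yields an invariant set of columns; irreducibility
  leaves only \<open>\<sigma>\<close> and \<open>\<tau>\<close>. The ring is arbitrary because the
  lemma is applied to polynomial matrices and to their specialization to scalars.\<close>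

lemma det_two_supported_columns:
  fixes A :: "'b::comm_ring_1 mat"
  assumes A: "A \<in> carrier_mat t t"
    and perm: "\<sigma> permutes {0..<t}" "\<tau> permutes {0..<t}" and neq: "\<sigma> \<noteq> \<tau>"
    and zero: "\<And>r c. r < t \<Longrightarrow> c < t \<Longrightarrow> r \<noteq> \<sigma> c \<Longrightarrow> r \<noteq> \<tau> c \<Longrightarrow> A $$ (r, c) = 0"
    and irred: "\<And>C. C \<subseteq> {0..<t} \<Longrightarrow> \<sigma> ` C = \<tau> ` C \<Longrightarrow> C = {} \<or> C = {0..<t}"
  shows "det A = signof \<sigma> * (\<Prod>c<t. A $$ (\<sigma> c, c)) + signof \<tau> * (\<Prod>c<t. A $$ (\<tau> c, c))"
proof -
  have "signof \<pi> * (\<Prod>c<t. A $$ (\<pi> c, c)) = 0"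
    if \<pi>: "\<pi> permutes {0..<t}" "\<pi> \<noteq> \<sigma>" "\<pi> \<noteq> \<tau>" for \<pi>
  proof -
    have ext: "p = p'" if "p permutes {0..<t}" "p' permutes {0..<t}" "\<forall>c<t. p c = p' c" for p p'
      using that by (metis atLeastLessThan_iff ext le0 permutes_not_in)
    have "\<exists>c<t. \<pi> c \<notin> {\<sigma> c, \<tau> c}"
    proof (rule ccontr)
      assume "\<not> ?thesis"
      then have mix: "\<And>c. c \<in> {0..<t} \<Longrightarrow> \<pi> c \<in> {\<sigma> c, \<tau> c}" by auto
      then have "{c\<in>{0..<t}. \<pi> c = \<tau> c} = {} \<or> {c\<in>{0..<t}. \<pi> c = \<tau> c} = {0..<t}"
        using mixed_permutation_invariant[OF perm \<pi>(1)] by (intro irred) auto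
      then show False
      proof
        assume "{c\<in>{0..<t}. \<pi> c = \<tau> c} = {}"
        then have "\<forall>c<t. \<pi> c = \<sigma> c" using mix by auto
        then show False using ext \<pi> perm by blast
      next
        assume "{c\<in>{0..<t}. \<pi> c = \<tau> c} = {0..<t}"
        from equalityD2[OF this] have "\<forall>c<t. \<pi> c = \<tau> c" by auto
        then show False using ext \<pi> perm by blast
      qed
    qed
    then obtain c where c: "c < t" "\<pi> c \<noteq> \<sigma> c" "\<pi> c \<noteq> \<tau> c" by auto
    moreover have "\<pi> c < t" using c(1) permutes_in_image[OF \<pi>(1), of c] by simp
    ultimately have "A $$ (\<pi> c, c) = 0" using zero by blast
    then show ?thesis using c(1) by (subst prod_zero) auto
  qed
  then have "det A = (\<Sum>\<pi>\<in>{\<sigma>, \<tau>}. signof \<pi> * (\<Prod>c<t. A $$ (\<pi> c, c)))"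
    unfolding det_col[OF A] using perm
    by (intro sum.mono_neutral_right) (auto simp: finite_permutations)
  then show ?thesis using neq by simp
qed

section \<open>Minors in which all variables are different\<close>

text \<open>The common shape of the submatrices in both directions of the correspondence:
  \<open>f\<close> collects the variables of the \<open>\<sigma>\<close> monomial and
  \<open>g\<close> those of the \<open>\<tau>\<close> monomial. The two entries of a column have
  opposite signs, which later decides the sign between the two monomials.\<close>

locale two_entry_columns =
  fixes t :: nat and \<sigma> \<tau> f g :: "nat \<Rightarrow> nat" and \<epsilon> :: "nat \<Rightarrow> 'k::field"
    and A :: "(nat, 'k) mpoly mat"
  assumes carrier: "A \<in> carrier_mat t t"
    and \<sigma>: "\<sigma> permutes {0..<t}" and \<tau>: "\<tau> permutes {0..<t}"
    and neq: "\<And>c. c < t \<Longrightarrow> \<sigma> c \<noteq> \<tau> c"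
    and entry_\<sigma>: "\<And>c. c < t \<Longrightarrow> A $$ (\<sigma> c, c) = Poly_Mapping.single (Poly_Mapping.single (f c) 1) (- \<epsilon> c)"
    and entry_\<tau>: "\<And>c. c < t \<Longrightarrow> A $$ (\<tau> c, c) = Poly_Mapping.single (Poly_Mapping.single (g c) 1) (\<epsilon> c)"
    and entry_0: "\<And>r c. r < t \<Longrightarrow> c < t \<Longrightarrow> r \<noteq> \<sigma> c \<Longrightarrow> r \<noteq> \<tau> c \<Longrightarrow> A $$ (r, c) = 0"
    and inj_f: "inj_on f {..<t}" and inj_g: "inj_on g {..<t}"
    and disj: "f ` {..<t} \<inter> g ` {..<t} = {}"
    and sign: "\<And>c. c < t \<Longrightarrow> \<epsilon> c = 1 \<or> \<epsilon> c = - 1"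
begin

text \<open>Every invariant set \<open>C\<close> contributes a monomial, and distinct ones cannot cancel because all
  \<open>2 * t\<close> variables are different.\<close>

lemma lookup_det_mixed_neq_0:
  assumes C: "C \<subseteq> {0..<t}" "\<sigma> ` C = \<tau> ` C"
  shows "Poly_Mapping.lookup (det A) (var_exp (\<lambda>c. if c \<in> C then g c else f c) t) \<noteq> 0"
proof -
  \<comment> \<open>Off row \<open>\<tau> c\<close> the variable is taken to be \<open>f c\<close>
    even where the entry is 0, so that \<open>det_monomial_matrix\<close> covers all
    entries.\<close>
  define h where "h r c = (if r = \<tau> c then g c else f c)" for r c
  define s where "s r c = (if r = \<tau> c then \<epsilon> c else if r = \<sigma> c then - \<epsilon> c else 0)" for r c
  have entry: "A $$ (r, c) = Poly_Mapping.single (Poly_Mapping.single (h r c) 1) (s r c)"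
    if "r < t" "c < t" for r c
    using that entry_\<sigma> entry_\<tau> entry_0 by (auto simp: h_def s_def)
  define \<pi> where "\<pi> = (\<lambda>c. if c \<in> C then \<tau> c else \<sigma> c)"
  have \<pi>: "\<pi> permutes {0..<t}" unfolding \<pi>_def by (rule permutes_mixed[OF \<sigma> \<tau> C])
  let ?m = "\<lambda>p. var_exp (\<lambda>c. h (p c) c) t"
  have m: "var_exp (\<lambda>c. if c \<in> C then g c else f c) t = ?m \<pi>"
    using neq by (intro var_exp_cong) (auto simp: h_def \<pi>_def)
  have unique: "p = \<pi>"
    if p: "p permutes {0..<t}" "?m p = ?m \<pi>" "(\<Prod>c<t. s (p c) c) \<noteq> 0" for p
  proof
    fix c
    show "p c = \<pi> c"
    proof (cases "c < t")
      case True
      have sup: "p d \<in> {\<sigma> d, \<tau> d}" if "d < t" for d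
        using p(3) that by (auto simp: s_def split: if_splits)
      \<comment> \<open>The columns in which a permutation follows \<open>\<tau>\<close> can be read
        off its monomial: they are those whose variable \<open>g c\<close> occurs. Hence the
        monomial determines the permutation.\<close>
      have mem: "g c \<in> (\<lambda>c. h (q c) c) ` {..<t} \<longleftrightarrow> q c = \<tau> c"
        for q
      proof
        assume "g c \<in> (\<lambda>c. h (q c) c) ` {..<t}"
        then obtain d where d: "d < t" "g c = h (q d) d" by auto
        then have "q d = \<tau> d" using disj True by (auto simp: h_def split: if_splits)
        then have "g c = g d" using d by (simp add: h_def)
        then have "c = d" using inj_g d True by (auto dest: inj_onD)
        then show "q c = \<tau> c" using \<open>q d = \<tau> d\<close> by simp
      qed (use True in \<open>auto simp: h_def image_iff intro!: bexI[of _ c]\<close>)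
      have "p c = \<tau> c \<longleftrightarrow> \<pi> c = \<tau> c"
        using arg_cong[OF p(2), of Poly_Mapping.keys] unfolding keys_var_exp
        using mem[of p] mem[of \<pi>] by simp
      moreover have "\<pi> c \<in> {\<sigma> c, \<tau> c}" by (simp add: \<pi>_def)
      ultimately show ?thesis using sup[OF True] by auto
    next
      case False then show ?thesis using p(1) \<pi> by (simp add: permutes_def)
    qed
  qed
  have det: "det A = (\<Sum>p | p permutes {0..<t}.
      Poly_Mapping.single (?m p) (signof p * (\<Prod>c<t. s (p c) c)))"
    by (rule det_monomial_matrix[OF carrier]) (rule entry)
  have "Poly_Mapping.lookup (det A) (?m \<pi>) =
      (\<Sum>p | p permutes {0..<t}. if p = \<pi> then signof \<pi> * (\<Prod>c<t. s (\<pi> c) c) else 0)"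
    unfolding det lookup_sum lookup_single when_def
  proof (rule sum.cong[OF refl], unfold mem_Collect_eq)
    fix p assume "p permutes {0..<t}"
    then show "(if ?m p = ?m \<pi> then signof p * (\<Prod>c<t. s (p c) c) else 0) =
        (if p = \<pi> then signof \<pi> * (\<Prod>c<t. s (\<pi> c) c) else 0)"
      using unique[of p] by (cases "(\<Prod>c<t. s (p c) c) = 0") auto
  qed
  also have "\<dots> = signof \<pi> * (\<Prod>c<t. s (\<pi> c) c)"
    using \<pi> by (simp add: finite_permutations)
  also have "\<dots> \<noteq> 0"
  proof -
    have "s (\<pi> c) c \<noteq> 0" if "c < t" for c
      using neq[OF that] sign[OF that] by (auto simp: s_def \<pi>_def)
    then show ?thesis by (auto simp: sign_def)
  qed
  finally show ?thesis by (simp only: m not_False_eq_True)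
qed

text \<open>A proper nonempty invariant set, the empty set and the full set would contribute three
  different monomials to the determinant, but a binomial has at most two.\<close>

lemma binomial_imp_irreducible:
  assumes binom: "det A = mono_poly \<mu> + mono_poly \<nu> \<or> det A = mono_poly \<mu> - mono_poly \<nu>"
    and C: "C \<subseteq> {0..<t}" "\<sigma> ` C = \<tau> ` C"
  shows "C = {} \<or> C = {0..<t}"
proof (rule ccontr)
  assume proper: "\<not> ?thesis"
  let ?m = "\<lambda>C. var_exp (\<lambda>c. if c \<in> C then g c else f c) t"
  have "Poly_Mapping.keys (det A) \<subseteq> {\<mu>, \<nu>}"
    using binom by (auto simp: in_keys_iff lookup_add lookup_minus lookup_single when_def split: if_splits)
  moreover have keys: "?m K \<in> Poly_Mapping.keys (det A)" if "K \<subseteq> {0..<t}" "\<sigma> ` K = \<tau> ` K" for K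
    unfolding in_keys_iff using that by (rule lookup_det_mixed_neq_0)
  have "?m {} \<in> Poly_Mapping.keys (det A)" by (rule keys) auto
  moreover have "?m C \<in> Poly_Mapping.keys (det A)" using C by (rule keys)
  moreover have "?m {0..<t} \<in> Poly_Mapping.keys (det A)"
    by (rule keys) (use permutes_image[OF \<sigma>] permutes_image[OF \<tau>] in auto)
  ultimately have coincide: "?m {} = ?m C \<or> ?m {} = ?m {0..<t} \<or> ?m C = ?m {0..<t}" by blast
  \<comment> \<open>Since \<open>g c\<close> is never one of the \<open>f d\<close>, the monomial
    belonging to \<open>K\<close> determines \<open>K\<close>.\<close>
  have mem: "g c \<in> Poly_Mapping.keys (?m K) \<longleftrightarrow> c \<in> K" if c: "c < t" for c K
  proof
    assume "g c \<in> Poly_Mapping.keys (?m K)"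
    then obtain d where d: "d < t" "g c = (if d \<in> K then g d else f d)"
      unfolding keys_var_exp by auto
    have "g c \<noteq> f d" using disj c d(1) by auto
    then have "d \<in> K" "g c = g d" using d(2) by (auto split: if_splits)
    then show "c \<in> K" using inj_g c d(1) by (auto dest: inj_onD)
  qed (use c in \<open>auto simp: keys_var_exp image_iff intro!: bexI[of _ c]\<close>)
  have "K = L" if "?m K = ?m L" "K \<subseteq> {0..<t}" "L \<subseteq> {0..<t}" for K L
  proof -
    have "c \<in> K \<longleftrightarrow> c \<in> L" if "c < t" for c
      using mem[OF that, of K] mem[OF that, of L] \<open>?m K = ?m L\<close> by simp
    then show ?thesis using that(2,3) by (auto simp: subset_eq)
  qed
  from this[of "{}" C] this[of "{}" "{0..<t}"] this[of C "{0..<t}"]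
  have "C = {} \<or> C = {0..<t}" using coincide C(1) by blast
  then show False using proper by contradiction
qed

text \<open>Only the terms of \<open>\<sigma>\<close> and \<open>\<tau>\<close> survive. Their
  coefficients are opposite because the determinant vanishes once all variables are set to 1; this
  avoids computing the signs of the two permutations. It also turns a minor that is given as a sum
  into a difference.\<close>

lemma det_irreducible:
  assumes t: "t > 0"
    and irred: "\<And>C. C \<subseteq> {0..<t} \<Longrightarrow> \<sigma> ` C = \<tau> ` C \<Longrightarrow> C = {} \<or> C = {0..<t}"
  shows "det A = mono_poly (var_exp f t) - mono_poly (var_exp g t) \<or>
    det A = - (mono_poly (var_exp f t) - mono_poly (var_exp g t))"
proof -
  have "\<sigma> \<noteq> \<tau>" using neq t by auto
  define a where "a = signof \<sigma> * (\<Prod>c<t. - \<epsilon> c)"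
  define b where "b = signof \<tau> * (\<Prod>c<t. \<epsilon> c)"
  have "det A = signof \<sigma> * (\<Prod>c<t. A $$ (\<sigma> c, c)) + signof \<tau> * (\<Prod>c<t. A $$ (\<tau> c, c))"
    using carrier \<sigma> \<tau> \<open>\<sigma> \<noteq> \<tau>\<close> entry_0 irred by (rule det_two_supported_columns)
  also have "\<dots> = Poly_Mapping.single (var_exp f t) a + Poly_Mapping.single (var_exp g t) b"
    unfolding a_def b_def
    by (simp add: entry_\<sigma> entry_\<tau> prod_single var_exp_def sign_def del: One_nat_def flip: single_uminus)
  finally have det: "det A = Poly_Mapping.single (var_exp f t) a + Poly_Mapping.single (var_exp g t) b" .
  \<comment> \<open>Setting all variables to 1 turns \<open>A\<close> into the matrix \<open>S\<close>, whose columns sum to 0.\<close>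
  define S where "S = mat t t (\<lambda>(r, c). if r = \<sigma> c then - \<epsilon> c else if r = \<tau> c then \<epsilon> c else 0)"
  have S: "S \<in> carrier_mat t t" by (simp add: S_def)
  have lt: "\<sigma> c < t" "\<tau> c < t" if "c < t" for c
    using that permutes_in_image[OF \<sigma>, of c] permutes_in_image[OF \<tau>, of c] by auto
  have S\<sigma>: "S $$ (\<sigma> c, c) = - \<epsilon> c" and S\<tau>: "S $$ (\<tau> c, c) = \<epsilon> c" if "c < t" for c
    using that lt[OF that] neq[OF that] by (auto simp: S_def)
  have "det S = signof \<sigma> * (\<Prod>c<t. S $$ (\<sigma> c, c)) + signof \<tau> * (\<Prod>c<t. S $$ (\<tau> c, c))"
    using \<sigma> \<tau> \<open>\<sigma> \<noteq> \<tau>\<close> irred by (intro det_two_supported_columns[OF S]) (auto simp: S_def)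
  also have "\<dots> = a + b" by (simp add: a_def b_def S\<sigma> S\<tau>)
  finally have "a + b = det S" by simp
  also have "det S = det (transpose_mat S)" using det_transpose[OF S] by simp
  also have "\<dots> = 0"
  proof (subst det_0_iff_vec_prod_zero_field)
    show "transpose_mat S \<in> carrier_mat t t" using S by simp
    let ?v = "vec t (\<lambda>_. 1 :: 'k)"
    have "transpose_mat S *\<^sub>v ?v = 0\<^sub>v t"
    proof (rule eq_vecI)
      fix c assume "c < dim_vec (0\<^sub>v t :: 'k vec)"
      then have c: "c < t" by simp
      have "(transpose_mat S *\<^sub>v ?v) $ c = (\<Sum>r\<in>{0..<t}. S $$ (r, c))"
        using c S by (simp add: scalar_prod_def)
      also have "\<dots> = (\<Sum>r\<in>{\<sigma> c, \<tau> c}. S $$ (r, c))"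
        using c lt[OF c] by (intro sum.mono_neutral_right) (auto simp: S_def)
      also have "\<dots> = 0" using neq[OF c] c by (simp add: S\<sigma> S\<tau>)
      finally show "(transpose_mat S *\<^sub>v ?v) $ c = 0\<^sub>v t $ c" using c by simp
    qed (use S in auto)
    moreover have "?v \<noteq> 0\<^sub>v t" using t by (metis index_vec index_zero_vec(1) zero_neq_one)
    ultimately show "\<exists>v. v \<in> carrier_vec t \<and> v \<noteq> 0\<^sub>v t \<and> transpose_mat S *\<^sub>v v = 0\<^sub>v t"
      by (intro exI[of _ ?v]) auto
  qed
  finally have "a = - b" by (simp add: eq_neg_iff_add_eq_0)
  moreover have "b = 1 \<or> b = - 1"
  proof -
    have "(\<Prod>c<n. \<epsilon> c) = 1 \<or> (\<Prod>c<n. \<epsilon> c) = - 1" if "n \<le> t" for n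
      using that
    proof (induction n)
      case (Suc n)
      then show ?case using sign[of n] by auto
    qed simp
    then show ?thesis unfolding b_def by (fastforce simp: sign_def)
  qed
  ultimately show ?thesis using det by (auto simp: single_uminus)
qed

end

section \<open>Entries of the reduced Jacobian dual\<close>

lemma single_one_eq_iff:
  "Poly_Mapping.single x (1::nat) = Poly_Mapping.single y 1 \<longleftrightarrow> x = y"
  by (metis lookup_single_eq lookup_single_not_eq zero_neq_one)

lemma single_one_add_eq_single_one_iff:
  "Poly_Mapping.single v (1::nat) + \<kappa> = Poly_Mapping.single w 1 \<longleftrightarrow> v = w \<and> \<kappa> = 0"
proof
  assume eq: "Poly_Mapping.single v (1::nat) + \<kappa> = Poly_Mapping.single w 1"
  have l: "Poly_Mapping.lookup (Poly_Mapping.single v (1::nat)) x + Poly_Mapping.lookup \<kappa> x =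
      Poly_Mapping.lookup (Poly_Mapping.single w 1) x" for x
    using arg_cong[OF eq, of "\<lambda>p. Poly_Mapping.lookup p x"] by (simp add: lookup_add)
  have "v = w" using l[of v] by (simp add: lookup_single when_def split: if_splits)
  moreover have "\<kappa> = 0"
    using eq unfolding \<open>v = w\<close> by (metis add_cancel_right_right)
  ultimately show "v = w \<and> \<kappa> = 0" by simp
qed simp

text \<open>A linear coefficient of \<open>Var v * q\<close> sees only the constant term of
  \<open>q\<close>. This is the link between reduction modulo the vertices and the linear part of
  the presentation matrix.\<close>

lemma lookup_Var_mult_single_one:
  fixes q :: "('v, 'k::comm_ring_1) mpoly"
  shows "Poly_Mapping.lookup (Var v * q) (Poly_Mapping.single w 1) = (if v = w then const_coeff q else 0)"
proof -
  have "Var v * q = (\<Sum>\<kappa>\<in>Poly_Mapping.keys q.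
      Poly_Mapping.single (Poly_Mapping.single v 1 + \<kappa>) (Poly_Mapping.lookup q \<kappa>))"
    by (subst poly_mapping_sum_single[of q]) (simp add: sum_distrib_left mult_single del: One_nat_def)
  then have "Poly_Mapping.lookup (Var v * q) (Poly_Mapping.single w 1) =
      (\<Sum>\<kappa>\<in>Poly_Mapping.keys q. if \<kappa> = 0 then (if v = w then const_coeff q else 0) else 0)"
    unfolding lookup_sum lookup_single when_def single_one_add_eq_single_one_iff
    by (auto simp: lookup_sum lookup_single when_def single_one_add_eq_single_one_iff
      simp del: One_nat_def intro!: sum.cong)
  then show ?thesis by (simp add: in_keys_iff)
qed

lemma lookup_Const_mult:
  fixes Q :: "('v, 'b::comm_ring_1) mpoly"
  shows "Poly_Mapping.lookup (Const p * Q) \<mu> = p * Poly_Mapping.lookup Q \<mu>"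
proof -
  have "Const p * Q = (\<Sum>\<kappa>\<in>Poly_Mapping.keys Q. Poly_Mapping.single \<kappa> (p * Poly_Mapping.lookup Q \<kappa>))"
    by (subst poly_mapping_sum_single[of Q]) (simp add: sum_distrib_left mult_single)
  then show ?thesis by (simp add: lookup_sum lookup_single when_def in_keys_iff)
qed

text \<open>Comparing the coefficients of \<open>T_i\<close> in the defining equation writes
  \<open>\<phi> $$ (i, c)\<close> as a combination of the vertices, whose coefficients are the
  \<open>T_i\<close> coefficients in column \<open>c\<close> of \<open>B\<close>. Its linear
  coefficient at \<open>vs ! a\<close> is the constant term of the one in row \<open>a\<close>.
  Hence the reduction does not depend on the choice of \<open>B\<close>.\<close>

lemma reduced_jacobian_dual_entry:
  fixes \<phi> :: "('v, 'k::comm_ring_1) mpoly mat"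
  assumes B: "jacobian_dual vs \<phi> B" and vs: "distinct vs"
    and a: "a < length vs" and c: "c < dim_col \<phi>"
  shows "reduce_mod_vars B $$ (a, c) = (\<Sum>i<dim_row \<phi>.
    Poly_Mapping.single (Poly_Mapping.single i 1)
      (Poly_Mapping.lookup (\<phi> $$ (i, c)) (Poly_Mapping.single (vs ! a) 1)))"
proof (rule poly_mapping_eqI)
  fix \<mu> :: "nat \<Rightarrow>\<^sub>0 nat"
  let ?r = "dim_row \<phi>" and ?n = "length vs"
  have dims: "B \<in> carrier_mat ?n (dim_col \<phi>)"
    and lin: "linear_in_T (set vs) ?r (B $$ (a, c))"
    and eq: "row_matrix (map Var [0..<?r]) * map_mat Const \<phi> =
       row_matrix (map (\<lambda>v. Const (Var v)) vs) * B"
    using B a c unfolding jacobian_dual_def by auto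
  have red: "Poly_Mapping.lookup (reduce_mod_vars B $$ (a, c)) \<mu> =
      const_coeff (Poly_Mapping.lookup (B $$ (a, c)) \<mu>)"
    using dims a c by (simp add: reduce_mod_vars_def Poly_Mapping.map.rep_eq when_def)
  have rhs: "Poly_Mapping.lookup (\<Sum>i<?r. Poly_Mapping.single (Poly_Mapping.single i 1)
      (Poly_Mapping.lookup (\<phi> $$ (i, c)) (Poly_Mapping.single (vs ! a) 1))) \<mu> =
      (\<Sum>i<?r. if Poly_Mapping.single i 1 = \<mu> then
        Poly_Mapping.lookup (\<phi> $$ (i, c)) (Poly_Mapping.single (vs ! a) 1) else 0)"
    by (simp add: lookup_sum lookup_single when_def del: One_nat_def)
  show "Poly_Mapping.lookup (reduce_mod_vars B $$ (a, c)) \<mu> =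
    Poly_Mapping.lookup (\<Sum>i<?r. Poly_Mapping.single (Poly_Mapping.single i 1)
      (Poly_Mapping.lookup (\<phi> $$ (i, c)) (Poly_Mapping.single (vs ! a) 1))) \<mu>"
  proof (cases "\<exists>i<?r. \<mu> = Poly_Mapping.single i 1")
    case False
    then have "\<mu> \<notin> Poly_Mapping.keys (B $$ (a, c))" using lin by (auto simp: linear_in_T_def)
    moreover have "(\<Sum>i<?r. if Poly_Mapping.single i 1 = \<mu> then
        Poly_Mapping.lookup (\<phi> $$ (i, c)) (Poly_Mapping.single (vs ! a) 1) else 0) = 0"
      using False by (intro sum.neutral) auto
    ultimately show ?thesis unfolding red rhs by (simp add: in_keys_iff)
  next
    case True
    then obtain i where i: "i < ?r" "\<mu> = Poly_Mapping.single i 1" by auto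
    have "(\<Sum>j<?r. Var j * Const (\<phi> $$ (j, c))) =
        (row_matrix (map Var [0..<?r]) * map_mat Const \<phi>) $$ (0, c)"
      using c by (simp add: row_matrix_def mat_of_rows_list_def scalar_prod_def atLeast0LessThan
        del: One_nat_def)
    also have "\<dots> = (\<Sum>b<?n. Const (Var (vs ! b)) * B $$ (b, c))"
      unfolding eq using c dims
      by (simp add: row_matrix_def mat_of_rows_list_def scalar_prod_def atLeast0LessThan
        del: One_nat_def)
    finally have "Poly_Mapping.lookup (\<Sum>j<?r. Var j * Const (\<phi> $$ (j, c))) \<mu> =
      Poly_Mapping.lookup (\<Sum>b<?n. Const (Var (vs ! b)) * B $$ (b, c)) \<mu>" by simp
    moreover have "Poly_Mapping.lookup (\<Sum>j<?r. Var j * Const (\<phi> $$ (j, c))) \<mu> = \<phi> $$ (i, c)"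
      using i by (simp add: lookup_sum mult_single lookup_single when_def single_one_eq_iff
        del: One_nat_def)
    ultimately have "\<phi> $$ (i, c) = (\<Sum>b<?n. Var (vs ! b) * Poly_Mapping.lookup (B $$ (b, c)) \<mu>)"
      by (simp add: lookup_sum lookup_Const_mult del: One_nat_def)
    then have "Poly_Mapping.lookup (\<phi> $$ (i, c)) (Poly_Mapping.single (vs ! a) 1) =
      (\<Sum>b<?n. if vs ! b = vs ! a then const_coeff (Poly_Mapping.lookup (B $$ (b, c)) \<mu>) else 0)"
      by (simp add: lookup_sum lookup_Var_mult_single_one del: One_nat_def)
    \<comment> \<open>As the vertices in \<open>vs\<close> are distinct, only the summand of row
      \<open>a\<close> remains.\<close>
    also have "\<dots> = (\<Sum>b<?n. if b = a then const_coeff (Poly_Mapping.lookup (B $$ (b, c)) \<mu>) else 0)"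
      using vs a by (intro sum.cong) (auto simp: nth_eq_iff_index_eq)
    also have "\<dots> = const_coeff (Poly_Mapping.lookup (B $$ (a, c)) \<mu>)" using a by simp
    finally show ?thesis unfolding red rhs using i
      by (simp add: single_one_eq_iff del: One_nat_def)
  qed
qed

text \<open>The entry of the reduced Jacobian dual in the row of the vertex \<open>v\<close> and the column of the
  pair \<open>(j, k)\<close> is \<open>entry_sign fs (j, k) v\<close> times the variable with index
  \<open>entry_var fs (j, k) v\<close>.\<close>

definition entry_var :: "'v set list \<Rightarrow> nat \<times> nat \<Rightarrow> 'v \<Rightarrow> nat" where
  "entry_var fs = (\<lambda>(j, k) v. if fs ! k - fs ! j = {v} then j else k)"

definition entry_sign :: "'v set list \<Rightarrow> nat \<times> nat \<Rightarrow> 'v \<Rightarrow> 'k::comm_ring_1" where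
  "entry_sign fs = (\<lambda>(j, k) v.
     if fs ! k - fs ! j = {v} then - 1 else if fs ! j - fs ! k = {v} then 1 else 0)"

text \<open>The quotient of the lcm by an edge is the product over the difference of the two edges,
  and it has a linear term at \<open>v\<close> exactly if that difference is \<open>{v}\<close>. The
  two differences are disjoint, so at most one of the rows \<open>j\<close> and \<open>k\<close> of
  \<open>\<phi>\<close> contributes. If neither does, the default variable in
  \<open>entry_var\<close> is multiplied by 0.\<close>

lemma reduced_taylor_jacobian_dual_entry:
  fixes B :: "(nat, ('v, 'k::comm_ring_1) mpoly) mpoly mat"
  assumes B: "jacobian_dual vs (taylor_matrix fs prs) B" and vs: "distinct vs"
    and prs: "enumerates prs (pair_indices (length fs))"
    and fin: "\<And>e. e \<in> set fs \<Longrightarrow> finite e"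
    and a: "a < length vs" and c: "c < length prs"
  shows "reduce_mod_vars B $$ (a, c) =
    Poly_Mapping.single (Poly_Mapping.single (entry_var fs (prs ! c) (vs ! a)) 1)
      (entry_sign fs (prs ! c) (vs ! a))"
proof -
  obtain j k where jk: "prs ! c = (j, k)" by fastforce
  then have "(j, k) \<in> pair_indices (length fs)"
    using prs c nth_mem by (fastforce simp: enumerates_def)
  then have lt: "j < length fs" "k < length fs" "j \<noteq> k" by (auto simp: pair_indices_def)
  then have fjk: "finite (fs ! j)" "finite (fs ! k)" using fin by auto
  let ?\<phi> = "taylor_matrix fs prs :: ('v, 'k) mpoly mat"
  let ?v = "vs ! a"
  let ?l = "lcm_exp (edge_exp (fs ! j)) (edge_exp (fs ! k))"
  have l: "?l - edge_exp (fs ! j) = edge_exp (fs ! k - fs ! j)"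
      "?l - edge_exp (fs ! k) = edge_exp (fs ! j - fs ! k)"
    using fjk by (auto intro!: poly_mapping_eqI simp: lookup_minus lcm_exp.rep_eq lookup_edge_exp)
  have iff: "edge_exp S = Poly_Mapping.single v 1 \<longleftrightarrow> S = {v}" if "finite S" for S and v :: 'v
  proof
    assume "edge_exp S = Poly_Mapping.single v 1"
    then have eq: "Poly_Mapping.lookup (edge_exp S) x = Poly_Mapping.lookup (Poly_Mapping.single v 1) x" for x
      by simp
    have "x \<in> S \<longleftrightarrow> x = v" for x
      using that eq[of x] by (simp add: lookup_edge_exp lookup_single when_def of_bool_def split: if_splits)
    then show "S = {v}" by auto
  qed (simp add: edge_exp_def)
  have \<phi>: "?\<phi> $$ (i, c) = (if i = j then - mono_poly (edge_exp (fs ! k - fs ! j))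
      else if i = k then mono_poly (edge_exp (fs ! j - fs ! k)) else 0)" if "i < length fs" for i
    using that c jk by (simp add: taylor_matrix_def Let_def l)
  have "reduce_mod_vars B $$ (a, c) = (\<Sum>i<length fs.
    Poly_Mapping.single (Poly_Mapping.single i 1)
      (Poly_Mapping.lookup (?\<phi> $$ (i, c)) (Poly_Mapping.single ?v 1)))"
    using reduced_jacobian_dual_entry[OF B vs a] c by (simp add: taylor_matrix_def)
  also have "\<dots> = (\<Sum>i\<in>{j, k}.
    Poly_Mapping.single (Poly_Mapping.single i 1)
      (Poly_Mapping.lookup (?\<phi> $$ (i, c)) (Poly_Mapping.single ?v 1)))"
    using lt by (intro sum.mono_neutral_right) (auto simp: \<phi>)
  also have "\<dots> = Poly_Mapping.single (Poly_Mapping.single j 1) (if fs ! k - fs ! j = {?v} then - 1 else 0)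
      + Poly_Mapping.single (Poly_Mapping.single k 1) (if fs ! j - fs ! k = {?v} then 1 else 0)"
    using lt fjk by (simp add: \<phi> lookup_single when_def iff del: One_nat_def)
  also have "\<dots> = Poly_Mapping.single (Poly_Mapping.single (entry_var fs (prs ! c) ?v) 1)
      (entry_sign fs (prs ! c) ?v)"
    unfolding jk entry_var_def entry_sign_def by auto
  finally show ?thesis .
qed

section \<open>Directed cycles and cyclic permutations\<close>

lemma pcas_map_upt:
  "pcas (a m) (map (\<lambda>i. (a i, a (Suc i))) [m..<m + n]) v \<longleftrightarrow> v = a (m + n)"
proof (induction n arbitrary: m)
  case (Suc n)
  then show ?case using Suc.IH[of "Suc m"] by (simp add: upt_conv_Cons del: upt_Suc)
qed auto

lemma pawalk_verts_map_upt:
  "pawalk_verts (a m) (map (\<lambda>i. (a i, a (Suc i))) [m..<m + n]) = map a [m..<Suc (m + n)]"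
proof (induction n arbitrary: m)
  case (Suc n)
  then show ?case using Suc.IH[of "Suc m"] by (simp add: upt_conv_Cons del: upt_Suc)
qed auto

lemma pcas_imp_map_upt:
  "pcas u p v \<Longrightarrow> \<exists>a. p = map (\<lambda>i. (a i, a (Suc i))) [0..<length p] \<and> a 0 = u \<and> a (length p) = v"
proof (induction p arbitrary: u)
  case Nil
  then show ?case by auto
next
  case (Cons e p)
  then obtain a where a: "p = map (\<lambda>i. (a i, a (Suc i))) [0..<length p]" "a 0 = snd e"
      "a (length p) = v" by auto
  \<comment> \<open>The vertex sequence of the tail is shifted by one and the start of the first arc
    is put in front.\<close>
  let ?a = "case_nat (fst e) a"
  have "e # p = map (\<lambda>i. (?a i, ?a (Suc i))) [0..<length (e # p)]"
    using a(2) by (simp add: upt_conv_Cons flip: map_Suc_upt del: upt_Suc)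
      (rule trans[OF a(1)], simp add: o_def)
  moreover have "?a 0 = u" using Cons.prems by simp
  moreover have "?a (length (e # p)) = v" using a(3) by simp
  ultimately show ?case by (intro exI[of _ ?a] conjI)
qed

text \<open>Describes a cycle by a vertex sequence indexed by numbers, so that its positions can be
  matched with the columns of a minor.\<close>

lemma cycle_iff:
  assumes D: "pair_digraph D"
  shows "pre_digraph.cycle (with_proj D) p \<longleftrightarrow>
    p \<noteq> [] \<and> (\<exists>a. p = map (\<lambda>i. (a i, a (Suc i))) [0..<length p] \<and> a (length p) = a 0 \<and>
      inj_on a {..<length p} \<and> set p \<subseteq> parcs D)" (is "?L \<longleftrightarrow> ?R")
proof -
  interpret pair_digraph D by fact
  \<comment> \<open>The definition of a cycle asks for distinctness of the vertices at positions 1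
    to \<open>n\<close>; as \<open>a n = a 0\<close>, this is a rotation of the positions 0 to
    \<open>n - 1\<close>.\<close>
  have inj: "distinct (map a [Suc 0..<Suc n]) \<longleftrightarrow> inj_on a {..<n}" if "a n = a 0" "n > 0" for a :: "nat \<Rightarrow> 'a" and n
  proof -
    have "distinct (map a [Suc 0..<Suc n]) \<longleftrightarrow> distinct (map a [Suc 0..<n] @ [a 0])"
      using that by simp
    also have "\<dots> \<longleftrightarrow> distinct (map a (0 # [Suc 0..<n]))" by auto
    also have "0 # [Suc 0..<n] = [0..<n]" using that by (simp add: upt_conv_Cons)
    finally show ?thesis by (simp add: distinct_map lessThan_atLeast0)
  qed
  show ?thesis
  proof
    assume ?L
    then obtain u where u: "u \<in> pverts D" "set p \<subseteq> parcs D" "pcas u p u"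
        "distinct (tl (pawalk_verts u p))" "p \<noteq> []"
      unfolding cycle_def awalk_def by auto
    obtain a where a: "p = map (\<lambda>i. (a i, a (Suc i))) [0..<length p]" "a 0 = u" "a (length p) = u"
      using pcas_imp_map_upt[OF u(3)] by auto
    have "pawalk_verts u p = map a [0..<Suc (length p)]"
      using pawalk_verts_map_upt[of a 0 "length p"] a by (metis add_0)
    then have "distinct (map a [Suc 0..<Suc (length p)])"
      using u(4) by (simp add: upt_conv_Cons del: upt_Suc)
    then have "inj_on a {..<length p}" using inj[of a "length p"] a u(5) by simp
    then show ?R using a u by auto
  next
    assume ?R
    then obtain a where p: "p \<noteq> []" and a: "p = map (\<lambda>i. (a i, a (Suc i))) [0..<length p]"
        "a (length p) = a 0" "inj_on a {..<length p}" "set p \<subseteq> parcs D" by auto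
    have "pawalk_verts (a 0) p = map a [0..<Suc (length p)]"
      using pawalk_verts_map_upt[of a 0 "length p"] a(1) by (metis add_0)
    then have "distinct (tl (pawalk_verts (a 0) p))"
      using inj[of a "length p"] a p by (simp add: upt_conv_Cons del: upt_Suc)
    moreover have "pcas (a 0) p (a 0)"
      using pcas_map_upt[of a 0 "length p" "a 0"] a(1,2) by (metis add_0)
    moreover have "a 0 \<in> pverts D"
    proof -
      have "(a 0, a 1) \<in> set p" using p by (subst a(1)) (auto simp: image_iff intro!: bexI[of _ 0])
      then show ?thesis using a(4) in_arcsD1 by blast
    qed
    ultimately show ?L unfolding cycle_def awalk_def using p a(4) by auto
  qed
qed

text \<open>The orbit of 0 is invariant and nonempty, hence it is everything, and the first return
  time to 0 equals the size \<open>t\<close> of the orbit.\<close>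

lemma irreducible_permutation_orbit:
  assumes n: "n permutes {0..<t}" and t: "t > 0"
    and irred: "\<And>C. C \<subseteq> {0..<t} \<Longrightarrow> n ` C = C \<Longrightarrow> C = {} \<or> C = {0..<t}"
  shows "bij_betw (\<lambda>i. (n ^^ i) 0) {..<t} {..<t}" and "(n ^^ t) 0 = 0"
proof -
  have perm: "permutation n" using n by (auto simp: permutation_permutes)
  have self: "0 \<in> orbit n 0" using perm by (rule permutation_self_in_orbit)
  have sub: "orbit n 0 \<subseteq> {0..<t}" using n t by (intro permutes_orbit_subset) auto
  have "n ` orbit n 0 = orbit n 0"
  proof (rule endo_inj_surj)
    show "finite (orbit n 0)" using sub by (rule finite_subset) simp
    show "n ` orbit n 0 \<subseteq> orbit n 0" by (auto intro: orbit.step)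
    show "inj_on n (orbit n 0)" using permutes_inj[OF n] by (rule inj_on_subset) simp
  qed
  then have orbit: "orbit n 0 = {0..<t}" using irred[OF sub] self by blast
  let ?d = "funpow_dist1 n 0 0"
  have img: "(\<lambda>i. (n ^^ i) 0) ` {0..<?d} = {0..<t}"
    using orbit_conv_funpow_dist1[OF self] orbit by simp
  have inj: "inj_on (\<lambda>i. (n ^^ i) 0) {0..<?d}" using self by (rule inj_on_funpow_dist1)
  have "?d = t" using card_image[OF inj] img by simp
  then show "bij_betw (\<lambda>i. (n ^^ i) 0) {..<t} {..<t}"
    using img inj by (simp add: bij_betw_def atLeast0LessThan)
  show "(n ^^ t) 0 = 0" using funpow_dist1_prop[OF self] \<open>?d = t\<close> by simp
qed

text \<open>Visiting \<open>z 0\<close>, \<open>z (n 0)\<close>, \<open>z (n (n 0))\<close> and so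
  on runs through every index once and closes up after \<open>t\<close> steps. Quantifying over
  \<open>F\<close> inside the existential lets one cycle serve both monomials.\<close>

lemma irreducible_permutation_cycle:
  assumes D: "pair_digraph D" and n: "n permutes {0..<t}" and t: "t > 0"
    and irred: "\<And>C. C \<subseteq> {0..<t} \<Longrightarrow> n ` C = C \<Longrightarrow> C = {} \<or> C = {0..<t}"
    and z: "inj_on z {..<t}" and arcs: "\<And>c. c < t \<Longrightarrow> (z c, z (n c)) \<in> parcs D"
  shows "\<exists>p. pre_digraph.cycle (with_proj D) p \<and> length p = t \<and>
    (\<forall>F :: 'a \<Rightarrow> 'a \<Rightarrow> 'c::comm_monoid_mult. (\<Prod>(z, w)\<leftarrow>p. F z w) = (\<Prod>c<t. F (z c) (z (n c))))"
proof -
  note orb = irreducible_permutation_orbit[OF n t irred]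
  define a where "a i = z ((n ^^ i) 0)" for i
  define p where "p = map (\<lambda>i. (a i, a (Suc i))) [0..<t]"
  have "(\<Prod>(z, w)\<leftarrow>p. F z w) = (\<Prod>c<t. F (z c) (z (n c)))" for F :: "'a \<Rightarrow> 'a \<Rightarrow> 'c"
  proof -
    have "(\<Prod>(z, w)\<leftarrow>p. F z w) = (\<Prod>i<t. F (a i) (a (Suc i)))"
      using prod.distinct_set_conv_list[of "[0..<t]" "\<lambda>i. F (a i) (a (Suc i))"]
      by (simp add: p_def o_def atLeast0LessThan)
    also have "\<dots> = (\<Prod>c<t. F (z c) (z (n c)))"
      using prod.reindex_bij_betw[OF orb(1), of "\<lambda>c. F (z c) (z (n c))"] by (simp add: a_def)
    finally show ?thesis .
  qed
  moreover have "pre_digraph.cycle (with_proj D) p"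
    unfolding cycle_iff[OF D]
  proof (intro conjI exI[of _ a])
    have lt: "(n ^^ i) 0 < t" if "i < t" for i using bij_betwE[OF orb(1)] that by auto
    show "set p \<subseteq> parcs D" using arcs lt by (auto simp: p_def a_def)
    have "inj_on (z \<circ> (\<lambda>i. (n ^^ i) 0)) {..<t}"
      using orb(1) z by (intro comp_inj_on) (auto simp: bij_betw_def)
    then show "inj_on a {..<length p}" by (simp add: a_def[abs_def] o_def p_def)
  qed (use t orb in \<open>auto simp: p_def a_def\<close>)
  moreover have "length p = t" by (simp add: p_def)
  ultimately show ?thesis by blast
qed

text \<open>The two rows of a column are the ends of a path of length 2 containing a matching edge,
  so they are both of the form \<open>X\<close> or both of the form \<open>Y\<close>. Neighbouring
  columns share a row and irreducibility links all columns, so one form prevails throughout. With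
  \<open>Y\<close> rows the permutation traces the cycle forwards, with \<open>X\<close> rows
  backwards.\<close>

lemma matching_minor_cycle:
  fixes \<rho> :: "nat \<Rightarrow> 'a bvert"
  assumes D: "pair_digraph D" and \<sigma>: "\<sigma> permutes {0..<t}" and \<tau>: "\<tau> permutes {0..<t}"
    and t: "t > 0"
    and irred: "\<And>C. C \<subseteq> {0..<t} \<Longrightarrow> \<sigma> ` C = \<tau> ` C \<Longrightarrow> C = {} \<or> C = {0..<t}"
    and \<rho>: "inj_on \<rho> {..<t}"
    and matching: "\<And>c. c < t \<Longrightarrow> m c \<in> bip_matching D"
    and edge: "\<And>c. c < t \<Longrightarrow> g c \<in> bip_edges D"
    and diff: "\<And>c. c < t \<Longrightarrow> g c - m c = {\<rho> (\<sigma> c)}" "\<And>c. c < t \<Longrightarrow> m c - g c = {\<rho> (\<tau> c)}"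
  shows "\<exists>p. pre_digraph.cycle (with_proj D) p \<and> length p = t \<and>
    (\<forall>F :: 'a bvert set \<Rightarrow> 'c::comm_monoid_mult.
      (\<Prod>(z, w)\<leftarrow>p. F {X z, Y z}) = (\<Prod>c<t. F (m c)) \<and>
      (\<Prod>(z, w)\<leftarrow>p. F {X z, Y w}) = (\<Prod>c<t. F (g c)))"
proof -
  have lt: "\<sigma> c < t" "\<tau> c < t" if "c < t" for c
    using that permutes_in_image[OF \<sigma>, of c] permutes_in_image[OF \<tau>, of c] by auto
  have "\<exists>z. m c = {X z, Y z}" if "c < t" for c using matching[OF that] by (auto simp: bip_matching_def)
  then obtain z where z: "\<And>c. c < t \<Longrightarrow> m c = {X (z c), Y (z c)}" by metis
  \<comment> \<open>In the first alternative the path has center \<open>X (z c)\<close> and the arc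
    leaves \<open>z c\<close>; in the second the center is \<open>Y (z c)\<close> and the arc enters
    \<open>z c\<close>.\<close>
  have cases: "(\<rho> (\<tau> c) = Y (z c) \<and> (\<exists>w. \<rho> (\<sigma> c) = Y w \<and> g c = {X (z c), Y w} \<and> (z c, w) \<in> parcs D)) \<or>
      (\<rho> (\<tau> c) = X (z c) \<and> (\<exists>w. \<rho> (\<sigma> c) = X w \<and> g c = {X w, Y (z c)} \<and> (w, z c) \<in> parcs D))"
    if c: "c < t" for c
  proof -
    obtain x y where xy: "g c = {X x, Y y}" "x = y \<or> (x, y) \<in> parcs D"
      using edge[OF c] by (auto simp: bip_edges_def bip_matching_def)
    have d: "{X x, Y y} - {X (z c), Y (z c)} = {\<rho> (\<sigma> c)}" "{X (z c), Y (z c)} - {X x, Y y} = {\<rho> (\<tau> c)}"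
      using diff[OF c] unfolding z[OF c] xy(1) by auto
    \<comment> \<open>Two equal edges have empty differences and two disjoint edges have differences
      with two elements, so exactly one endpoint is shared.\<close>
    consider "x = z c" "y = z c" | "x = z c" "y \<noteq> z c" | "x \<noteq> z c" "y = z c" | "x \<noteq> z c" "y \<noteq> z c"
      by blast
    then show ?thesis
    proof cases
      case 2
      then have "{X x, Y y} - {X (z c), Y (z c)} = {Y y}" "{X (z c), Y (z c)} - {X x, Y y} = {Y (z c)}"
        by auto
      then have "\<rho> (\<sigma> c) = Y y" "\<rho> (\<tau> c) = Y (z c)" using d by simp_all
      then show ?thesis using xy 2 by auto
    next
      case 3
      then have "{X x, Y y} - {X (z c), Y (z c)} = {X x}" "{X (z c), Y (z c)} - {X x, Y y} = {X (z c)}"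
        by auto
      then have "\<rho> (\<sigma> c) = X x" "\<rho> (\<tau> c) = X (z c)" using d by simp_all
      then show ?thesis using xy 3 by auto
    next
      case 4
      then have "{X (z c), Y (z c)} - {X x, Y y} = {X (z c), Y (z c)}" by auto
      then have "X (z c) = Y (z c)" using d(2) by (metis insertI1 insertI2 singletonD)
      then show ?thesis by simp
    qed (use d in simp)
  qed
  \<comment> \<open>\<open>n\<close> leads from column \<open>c\<close> to the column whose
    \<open>\<tau>\<close> row is the \<open>\<sigma>\<close> row of \<open>c\<close>. A set of
    columns has equal images under \<open>\<sigma>\<close> and \<open>\<tau>\<close> exactly if
    \<open>n\<close> preserves it.\<close>
  define n where "n = Hilbert_Choice.inv \<tau> \<circ> \<sigma>"
  have n: "n permutes {0..<t}" unfolding n_def using \<sigma> \<tau> by (intro permutes_compose permutes_inv)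
  have \<tau>n: "\<tau> (n c) = \<sigma> c" for c unfolding n_def using permutes_inverses(1)[OF \<tau>] by simp
  have n_lt: "n c < t" if "c < t" for c using permutes_in_image[OF n, of c] that by auto
  have inj\<tau>: "inj_on \<tau> S" for S using permutes_inj[OF \<tau>] by (rule inj_on_subset) auto
  have n_irred: "C = {} \<or> C = {0..<t}" if "C \<subseteq> {0..<t}" "n ` C = C" for C
  proof (rule irred)
    show "\<sigma> ` C = \<tau> ` C" using that(2) \<tau>n by (metis (no_types, lifting) image_cong image_image)
  qed fact
  have inv_irred: "C = {} \<or> C = {0..<t}" if C: "C \<subseteq> {0..<t}" "Hilbert_Choice.inv n ` C = C" for C
  proof (rule n_irred[OF C(1)])
    have "n ` C = n ` Hilbert_Choice.inv n ` C" using C(2) by simp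
    then show "n ` C = C" by (simp add: image_image permutes_inverses[OF n])
  qed
  \<comment> \<open>The columns with rows of the form \<open>Y\<close>. Within a column both rows
    have the same form, and the \<open>\<sigma>\<close> row of \<open>c\<close> is the
    \<open>\<tau>\<close> row of \<open>n c\<close>, so \<open>n\<close> preserves
    \<open>P\<close>.\<close>
  define P where "P = {c\<in>{0..<t}. \<rho> (\<tau> c) \<in> range Y}"
  have "\<sigma> ` P = \<tau> ` P"
  proof -
    have mem: "c \<in> P \<longleftrightarrow> n c \<in> P" if "c < t" for c
      using cases[OF that] that n_lt[OF that] by (auto simp: P_def \<tau>n)
    have "n ` P = P"
    proof
      show "n ` P \<subseteq> P" using mem by (auto simp: P_def)
      have "inj_on n P" using permutes_inj[OF n] by (rule inj_on_subset) auto
      moreover have "finite P" by (simp add: P_def)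
      ultimately show "P \<subseteq> n ` P" using \<open>n ` P \<subseteq> P\<close> by (metis card_image card_subset_eq order_refl)
    qed
    then show ?thesis using \<tau>n by (metis (no_types, lifting) image_cong image_image)
  qed
  then have "P = {} \<or> P = {0..<t}" by (intro irred) (auto simp: P_def)
  then show ?thesis
  proof
    assume P: "P = {0..<t}"
    have Y: "\<rho> (\<tau> c) = Y (z c)" if "c < t" for c
    proof -
      have "c \<in> P" using P that by simp
      then show ?thesis using cases[OF that] by (auto simp: P_def)
    qed
    have g: "g c = {X (z c), Y (z (n c))}" and arc: "(z c, z (n c)) \<in> parcs D" if "c < t" for c
      using cases[OF that] Y[OF that] Y[OF n_lt[OF that]] by (auto simp: \<tau>n)
    have "inj_on z {..<t}"
    proof (rule inj_onI)
      fix c d assume "c \<in> {..<t}" "d \<in> {..<t}" "z c = z d"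
      then have "\<rho> (\<tau> c) = \<rho> (\<tau> d)" using Y by simp
      then show "c = d" using \<rho> lt inj\<tau>[of UNIV] \<open>c \<in> {..<t}\<close> \<open>d \<in> {..<t}\<close> by (auto dest!: inj_onD)
    qed
    from irreducible_permutation_cycle[OF D n t n_irred this arc, where 'c = 'c]
    obtain p where p: "pre_digraph.cycle (with_proj D) p" "length p = t"
      "\<And>F :: 'a \<Rightarrow> 'a \<Rightarrow> 'c. (\<Prod>(z, w)\<leftarrow>p. F z w) = (\<Prod>c<t. F (z c) (z (n c)))" by blast
    show ?thesis
      by (rule exI[of _ p]) (use p z g in simp)
  next
    assume P: "P = {}"
    have X: "\<rho> (\<tau> c) = X (z c)" if "c < t" for c
    proof -
      have "c \<notin> P" using P by simp
      then show ?thesis using cases[OF that] that by (auto simp: P_def)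
    qed
    have g: "g c = {X (z (n c)), Y (z c)}" and arc: "(z (n c), z c) \<in> parcs D" if "c < t" for c
      using cases[OF that] X[OF that] X[OF n_lt[OF that]] by (auto simp: \<tau>n)
    have "inj_on z {..<t}"
    proof (rule inj_onI)
      fix c d assume "c \<in> {..<t}" "d \<in> {..<t}" "z c = z d"
      then have "\<rho> (\<tau> c) = \<rho> (\<tau> d)" using X by simp
      then show "c = d" using \<rho> lt inj\<tau>[of UNIV] \<open>c \<in> {..<t}\<close> \<open>d \<in> {..<t}\<close> by (auto dest!: inj_onD)
    qed
    \<comment> \<open>The arcs run from \<open>z (n c)\<close> to \<open>z c\<close>, so the cycle
      follows the inverse of \<open>n\<close>.\<close>
    moreover have "(z c, z (Hilbert_Choice.inv n c)) \<in> parcs D" if "c < t" for c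
      using arc[of "Hilbert_Choice.inv n c"] permutes_in_image[OF permutes_inv[OF n], of c] that
      by (simp add: permutes_inverses[OF n])
    ultimately obtain p where p: "pre_digraph.cycle (with_proj D) p" "length p = t"
      "\<And>F :: 'a \<Rightarrow> 'a \<Rightarrow> 'c. (\<Prod>(z, w)\<leftarrow>p. F z w) = (\<Prod>c<t. F (z c) (z (Hilbert_Choice.inv n c)))"
      using irreducible_permutation_cycle[OF D permutes_inv[OF n] t inv_irred, of z, where 'c = 'c] by blast
    \<comment> \<open>Reindexing by \<open>n\<close> assigns to column \<open>c\<close> the arc that
      enters \<open>z c\<close>, whose edge is \<open>g c\<close>.\<close>
    have "(\<Prod>c<t. F {X (z c), Y (z (Hilbert_Choice.inv n c))}) = (\<Prod>c<t. F (g c))" for F :: "'a bvert set \<Rightarrow> 'c"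
    proof -
      have "(\<Prod>c<t. F {X (z c), Y (z (Hilbert_Choice.inv n c))}) = (\<Prod>c<t. F {X (z (n c)), Y (z (Hilbert_Choice.inv n (n c)))})"
        using prod.permute[OF n, of "\<lambda>c. F {X (z c), Y (z (Hilbert_Choice.inv n c))}"]
        by (simp add: atLeast0LessThan o_def)
      then show ?thesis using g by (simp add: permutes_inverses[OF n])
    qed
    then show ?thesis
      by (intro exI[of _ p]) (use p z in simp)
  qed
qed

section \<open>Minors of the reduced Jacobian dual\<close>

lemma bij_betw_pick: "finite S \<Longrightarrow> bij_betw (pick S) {..<card S} S"
proof -
  assume S: "finite S"
  have "inj_on (pick S) {..<card S}"
    by (rule linorder_inj_onI) (use pick_mono_le in force)+
  moreover have "pick S ` {..<card S} \<subseteq> S" using pick_in_set_le by auto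
  ultimately show ?thesis
    using S by (simp add: bij_betw_def card_image card_subset_eq)
qed

text \<open>Supplies the permutations \<open>\<sigma>\<close> and \<open>\<tau>\<close> behind the
  two monomials of a binomial minor: a monomial with nonzero coefficient comes from some Leibniz
  term, all of whose entries are nonzero.\<close>

lemma det_monomial_matrix_coeff:
  fixes A :: "(nat, 'k::comm_ring_1) mpoly mat"
  assumes A: "A \<in> carrier_mat t t"
    and entry: "\<And>r c. r < t \<Longrightarrow> c < t \<Longrightarrow>
      A $$ (r, c) = Poly_Mapping.single (Poly_Mapping.single (h r c) 1) (s r c)"
    and coeff: "Poly_Mapping.lookup (det A) \<mu> \<noteq> 0"
  obtains \<pi> where "\<pi> permutes {0..<t}" "\<mu> = var_exp (\<lambda>c. h (\<pi> c) c) t"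
    "\<And>c. c < t \<Longrightarrow> s (\<pi> c) c \<noteq> 0"
proof -
  have det: "det A = (\<Sum>\<pi> | \<pi> permutes {0..<t}.
      Poly_Mapping.single (var_exp (\<lambda>c. h (\<pi> c) c) t) (signof \<pi> * (\<Prod>c<t. s (\<pi> c) c)))"
    by (rule det_monomial_matrix[OF A]) (rule entry)
  obtain \<pi> where \<pi>: "\<pi> permutes {0..<t}"
    and nz: "Poly_Mapping.lookup (Poly_Mapping.single (var_exp (\<lambda>c. h (\<pi> c) c) t)
      (signof \<pi> * (\<Prod>c<t. s (\<pi> c) c))) \<mu> \<noteq> 0"
    using coeff unfolding det lookup_sum by (auto elim!: sum.not_neutral_contains_not_neutral)
  then have "\<mu> = var_exp (\<lambda>c. h (\<pi> c) c) t" and "(\<Prod>c<t. s (\<pi> c) c) \<noteq> 0"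
    by (auto simp: lookup_single when_def split: if_splits)
  moreover have "s (\<pi> c) c \<noteq> 0" if "c < t" for c
  proof
    assume "s (\<pi> c) c = 0"
    then have "(\<Prod>c<t. s (\<pi> c) c) = 0" using that by (intro prod_zero) auto
    then show False using calculation(2) by contradiction
  qed
  ultimately show ?thesis using that \<pi> by blast
qed

text \<open>Variables and rows are crossed: the end \<open>u\<close> lies on edge \<open>g\<close>
  but carries the variable of edge \<open>f\<close>, and vice versa. The order of the two edges in
  \<open>jk\<close> only affects the sign of the whole column.\<close>

lemma entry_of_two_edges:
  assumes "jk = (f, g) \<or> jk = (g, f)" and "fs ! g - fs ! f = {u}" "fs ! f - fs ! g = {v}"
  shows "entry_var fs jk u = f" "entry_var fs jk v = g"
    "entry_sign fs jk u = - (entry_sign fs jk v :: 'k::comm_ring_1)"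
    "entry_sign fs jk v = (1 :: 'k) \<or> entry_sign fs jk v = (- 1 :: 'k)"
    "w \<noteq> u \<Longrightarrow> w \<noteq> v \<Longrightarrow> entry_sign fs jk w = (0 :: 'k)"
proof -
  have "u \<noteq> v" using assms(2,3) by blast
  then show "entry_var fs jk u = f" "entry_var fs jk v = g"
    "entry_sign fs jk u = - (entry_sign fs jk v :: 'k::comm_ring_1)"
    "entry_sign fs jk v = (1 :: 'k) \<or> entry_sign fs jk v = (- 1 :: 'k)"
    "w \<noteq> u \<Longrightarrow> w \<noteq> v \<Longrightarrow> entry_sign fs jk w = (0 :: 'k)"
    using assms(1) by (elim disjE; simp add: entry_var_def entry_sign_def assms(2,3) \<open>u \<noteq> v\<close>[symmetric])+
qed

text \<open>The converse of the previous lemma: two nonzero entries of a column with different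
  variables must sit at the two ends of its path.\<close>

lemma two_edges_of_entries:
  assumes "entry_sign fs jk u \<noteq> (0 :: 'k::comm_ring_1)" "entry_sign fs jk v \<noteq> (0 :: 'k)"
    and "entry_var fs jk u \<noteq> entry_var fs jk v"
  shows "jk = (entry_var fs jk u, entry_var fs jk v) \<or> jk = (entry_var fs jk v, entry_var fs jk u)"
    "fs ! entry_var fs jk v - fs ! entry_var fs jk u = {u}"
    "fs ! entry_var fs jk u - fs ! entry_var fs jk v = {v}"
  using assms by (cases jk; simp add: entry_var_def entry_sign_def split: if_splits)+

locale bip_jacobian_dual =
  fixes D :: "'a pair_pre_digraph"
    and zs :: "'a list"
    and fs :: "'a bvert set list"
    and prs :: "(nat \<times> nat) list"
    and B :: "(nat, ('a bvert, 'k::field) mpoly) mpoly mat"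
  assumes D: "pair_digraph D"
    and zs: "enumerates zs (pverts D)"
    and fs: "enumerates fs (bip_edges D)"
    and prs: "enumerates prs (pair_indices (length fs))"
    and B: "jacobian_dual (bip_vars zs) (taylor_matrix fs prs) B"
begin

abbreviation "vs \<equiv> bip_vars zs"
abbreviation "M \<equiv> reduce_mod_vars B"

definition edge_index :: "'a bvert set \<Rightarrow> nat" where
  "edge_index e = (THE i. i < length fs \<and> fs ! i = e)"

lemma T_of_eq: "T_of fs e = Var (edge_index e)"
  by (simp add: T_of_def edge_index_def)

lemma edge_index_nth: "i < length fs \<Longrightarrow> edge_index (fs ! i) = i"
  using fs unfolding edge_index_def enumerates_def by (auto simp: nth_eq_iff_index_eq)

lemma edge_index:
  assumes "e \<in> bip_edges D"
  shows "edge_index e < length fs" "fs ! edge_index e = e"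
proof -
  obtain i where "i < length fs" "fs ! i = e"
    using assms fs by (metis enumerates_def in_set_conv_nth)
  then show "edge_index e < length fs" "fs ! edge_index e = e" using edge_index_nth by auto
qed

lemma nth_fs: "i < length fs \<Longrightarrow> fs ! i \<in> bip_edges D"
  using fs nth_mem by (auto simp: enumerates_def)

lemma matching_subset_edges: "bip_matching D \<subseteq> bip_edges D"
  by (simp add: bip_edges_def)

lemma distinct_vs: "distinct vs"
  using zs by (auto simp: bip_vars_def enumerates_def distinct_map inj_on_def)

lemma set_vs: "set vs = X ` pverts D \<union> Y ` pverts D"
  using zs by (simp add: bip_vars_def enumerates_def)

lemma dims: "dim_row M = length vs" "dim_col M = length prs"
  using B unfolding jacobian_dual_def reduce_mod_vars_def taylor_matrix_def by auto

lemma entry: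
  assumes "a < length vs" "c < length prs"
  shows "M $$ (a, c) = Poly_Mapping.single (Poly_Mapping.single (entry_var fs (prs ! c) (vs ! a)) 1)
      (entry_sign fs (prs ! c) (vs ! a))"
proof (rule reduced_taylor_jacobian_dual_entry[OF B distinct_vs prs _ assms])
  fix e assume "e \<in> set fs"
  then show "finite e" using fs by (auto simp: enumerates_def bip_edges_def bip_matching_def)
qed

section \<open>Square submatrices of the reduced Jacobian dual\<close>

context
  fixes I J :: "nat set" and t :: nat
  assumes I: "I \<subseteq> {..<dim_row M}" "card I = t" and J: "J \<subseteq> {..<dim_col M}" "card J = t"
begin

abbreviation "row_vertex \<equiv> \<lambda>r. vs ! pick I r"
abbreviation "col_pair \<equiv> \<lambda>c. prs ! pick J c"

lemma bij_betw_pick_rows: "bij_betw (pick I) {..<t} I"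
  using bij_betw_pick[of I] I finite_subset by blast

lemma bij_betw_pick_cols: "bij_betw (pick J) {..<t} J"
  using bij_betw_pick[of J] J finite_subset by blast

lemma pick_lt: "r < t \<Longrightarrow> pick I r < length vs" "c < t \<Longrightarrow> pick J c < length prs"
  using bij_betwE[OF bij_betw_pick_rows] bij_betwE[OF bij_betw_pick_cols] I J dims by auto

lemma submatrix_carrier: "submatrix M I J \<in> carrier_mat t t"
proof -
  have "{i. i < dim_row M \<and> i \<in> I} = I" "{i. i < dim_col M \<and> i \<in> J} = J" using I J by auto
  then show ?thesis using I J dim_submatrix by (metis carrier_matI)
qed

lemma submatrix_entry:
  assumes "r < t" "c < t"
  shows "submatrix M I J $$ (r, c) =
    Poly_Mapping.single (Poly_Mapping.single (entry_var fs (col_pair c) (row_vertex r)) 1)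
      (entry_sign fs (col_pair c) (row_vertex r))"
proof -
  have "{i. i < dim_row M \<and> i \<in> I} = I" "{i. i < dim_col M \<and> i \<in> J} = J" using I J by auto
  then have "submatrix M I J $$ (r, c) = M $$ (pick I r, pick J c)"
    using I J assms by (intro submatrix_index) auto
  then show ?thesis using entry pick_lt assms by simp
qed

lemma inj_row_vertex: "inj_on row_vertex {..<t}"
proof (rule inj_onI)
  fix r r' assume "r \<in> {..<t}" "r' \<in> {..<t}" "row_vertex r = row_vertex r'"
  moreover from this have "pick I r = pick I r'"
    using pick_lt distinct_vs by (simp add: nth_eq_iff_index_eq)
  ultimately show "r = r'" using bij_betw_pick_rows by (auto simp: bij_betw_def dest: inj_onD)
qed

text \<open>Column \<open>c\<close> is the path with edges \<open>f c\<close> and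
  \<open>g c\<close>, ending at the rows \<open>\<sigma> c\<close> and \<open>\<tau> c\<close>. Both
  directions of the correspondence enter the determinant computation through this lemma.\<close>

lemma two_entry_columns_submatrix:
  assumes perm: "\<sigma> permutes {0..<t}" "\<tau> permutes {0..<t}"
    and pair: "\<And>c. c < t \<Longrightarrow> col_pair c = (f c, g c) \<or> col_pair c = (g c, f c)"
    and diff: "\<And>c. c < t \<Longrightarrow> fs ! g c - fs ! f c = {row_vertex (\<sigma> c)}"
      "\<And>c. c < t \<Longrightarrow> fs ! f c - fs ! g c = {row_vertex (\<tau> c)}"
    and inj: "inj_on f {..<t}" "inj_on g {..<t}" "f ` {..<t} \<inter> g ` {..<t} = {}"
  shows "two_entry_columns t \<sigma> \<tau> f g (\<lambda>c. entry_sign fs (col_pair c) (row_vertex (\<tau> c)))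
    (submatrix M I J)"
proof
  fix c assume c: "c < t"
  have lt: "\<sigma> c < t" "\<tau> c < t"
    using c permutes_in_image[OF perm(1), of c] permutes_in_image[OF perm(2), of c] by auto
  note e = entry_of_two_edges(1,2)[OF pair[OF c] diff(1)[OF c] diff(2)[OF c]]
    entry_of_two_edges(3-5)[OF pair[OF c] diff(1)[OF c] diff(2)[OF c], where 'k = 'k]
  show "\<sigma> c \<noteq> \<tau> c"
  proof
    assume "\<sigma> c = \<tau> c"
    then have "fs ! g c - fs ! f c = fs ! f c - fs ! g c" using diff[OF c] by simp
    then show False using diff(1)[OF c] by blast
  qed
  show "submatrix M I J $$ (\<sigma> c, c) = Poly_Mapping.single (Poly_Mapping.single (f c) 1)
      (- entry_sign fs (col_pair c) (row_vertex (\<tau> c)))"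
    unfolding submatrix_entry[OF lt(1) c] e(1,3) by simp
  show "submatrix M I J $$ (\<tau> c, c) = Poly_Mapping.single (Poly_Mapping.single (g c) 1)
      (entry_sign fs (col_pair c) (row_vertex (\<tau> c)))"
    unfolding submatrix_entry[OF lt(2) c] e(2) by simp
  show "entry_sign fs (col_pair c) (row_vertex (\<tau> c)) = (1 :: 'k) \<or>
      entry_sign fs (col_pair c) (row_vertex (\<tau> c)) = (- 1 :: 'k)"
    by (rule e(4))
  show "submatrix M I J $$ (r, c) = 0" if r: "r < t" "r \<noteq> \<sigma> c" "r \<noteq> \<tau> c" for r
  proof -
    have "row_vertex r \<noteq> row_vertex (\<sigma> c)" "row_vertex r \<noteq> row_vertex (\<tau> c)"
      using r lt inj_row_vertex by (auto dest: inj_onD)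
    then show ?thesis unfolding submatrix_entry[OF r(1) c] by (simp add: e(5))
  qed
qed (use perm inj submatrix_carrier in auto)

text \<open>A product of matching variables can only equal the \<open>f\<close> monomial if every
  \<open>f c\<close> is the index of a matching edge; \<open>matching_minor_cycle\<close> then
  supplies the cycle.\<close>

lemma matching_monomial_cycle:
  assumes perm: "\<sigma> permutes {0..<t}" "\<tau> permutes {0..<t}" and t: "t > 0"
    and irred: "\<And>C. C \<subseteq> {0..<t} \<Longrightarrow> \<sigma> ` C = \<tau> ` C \<Longrightarrow> C = {} \<or> C = {0..<t}"
    and lt: "\<And>c. c < t \<Longrightarrow> f c < length fs" "\<And>c. c < t \<Longrightarrow> g c < length fs"
    and diff: "\<And>c. c < t \<Longrightarrow> fs ! g c - fs ! f c = {row_vertex (\<sigma> c)}"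
      "\<And>c. c < t \<Longrightarrow> fs ! f c - fs ! g c = {row_vertex (\<tau> c)}"
    and N: "N \<subseteq> bip_matching D"
      "mono_poly (var_exp f t) = (\<Prod>e\<in>N. T_of fs e :: (nat, 'k) mpoly)"
  shows "\<exists>p. pre_digraph.cycle (with_proj D) p \<and> length p = t \<and>
    cycle_binomial fs p =
      (mono_poly (var_exp f t) - mono_poly (var_exp g t) :: (nat, 'k) mpoly)"
proof -
  have "mono_poly (var_exp f t) =
      (mono_poly (\<Sum>e\<in>N. Poly_Mapping.single (edge_index e) 1) :: (nat, 'k) mpoly)"
    unfolding N(2) T_of_eq prod_single by simp
  \<comment> \<open>The key of a monomial with coefficient 1 is its exponent, so the exponents
    agree.\<close>
  from arg_cong[OF this, of Poly_Mapping.keys]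
  have "var_exp f t = (\<Sum>e\<in>N. Poly_Mapping.single (edge_index e) 1)" by simp
  then have "f ` {..<t} = Poly_Mapping.keys (\<Sum>e\<in>N. Poly_Mapping.single (edge_index e) (1::nat))"
    by (metis keys_var_exp)
  also have "\<dots> \<subseteq> edge_index ` N"
    using keys_sum[of "\<lambda>e. Poly_Mapping.single (edge_index e) (1::nat)" N] by auto
  finally have f: "f c \<in> edge_index ` N" if "c < t" for c using that by auto
  have "fs ! f c \<in> bip_matching D" if c: "c < t" for c
  proof -
    obtain e where "f c = edge_index e" "e \<in> N" using f[OF c] by blast
    moreover from this have "e \<in> bip_matching D" using N(1) by blast
    ultimately show ?thesis using matching_subset_edges edge_index(2)[of e] by (simp add: subset_iff)
  qed
  moreover have "fs ! g c \<in> bip_edges D" if "c < t" for c using lt that nth_fs by blast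
  ultimately obtain p where p: "pre_digraph.cycle (with_proj D) p" "length p = t"
    "\<And>F :: 'a bvert set \<Rightarrow> (nat, 'k) mpoly.
      (\<Prod>(z, w)\<leftarrow>p. F {X z, Y z}) = (\<Prod>c<t. F (fs ! f c)) \<and>
      (\<Prod>(z, w)\<leftarrow>p. F {X z, Y w}) = (\<Prod>c<t. F (fs ! g c))"
    using matching_minor_cycle[OF D perm t irred inj_row_vertex, of "\<lambda>c. fs ! f c" "\<lambda>c. fs ! g c",
      where 'c = "(nat, 'k) mpoly"] diff by blast
  have "cycle_binomial fs p =
      (mono_poly (var_exp f t) - mono_poly (var_exp g t) :: (nat, 'k) mpoly)"
    unfolding cycle_binomial_def mono_poly_var_exp
    using p(3)[of "T_of fs"] lt by (simp add: T_of_eq edge_index_nth del: One_nat_def)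
  then show ?thesis using p by blast
qed

end

section \<open>From binomial minors to directed cycles\<close>

text \<open>Both monomials occur in the determinant and yield \<open>\<sigma>\<close> and
  \<open>\<tau>\<close>. Coprimality makes their choices differ in every column, so each column lies
  completely in the minor, and being a binomial forces irreducibility.\<close>

lemma cycle_minor_imp_cycle:
  assumes "cycle_minor D fs prs M t q"
  shows "\<exists>p. pre_digraph.cycle (with_proj D) p \<and> length p = t \<and>
    (q = cycle_binomial fs p \<or> q = - cycle_binomial fs p)"
proof -
  obtain I J \<mu> \<nu> N where I: "I \<subseteq> {..<dim_row M}" "card I = t"
    and J: "J \<subseteq> {..<dim_col M}" "card J = t" and q: "q = det (submatrix M I J)"
    and neq: "\<mu> \<noteq> \<nu>" and binom: "q = mono_poly \<mu> + mono_poly \<nu> \<or> q = mono_poly \<mu> - mono_poly \<nu>"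
    and sqf: "squarefree_exp \<mu>" "squarefree_exp \<nu>" and cop: "coprime_exp \<mu> \<nu>"
    and N: "N \<subseteq> bip_matching D" "mono_poly \<mu> = (\<Prod>e\<in>N. T_of fs e :: (nat, 'k) mpoly) \<or>
      mono_poly \<nu> = (\<Prod>e\<in>N. T_of fs e :: (nat, 'k) mpoly)"
    using assms unfolding cycle_minor_def by blast
  let ?\<rho> = "\<lambda>r. vs ! pick I r" and ?\<kappa> = "\<lambda>c. prs ! pick J c"
  let ?h = "\<lambda>r c. entry_var fs (?\<kappa> c) (?\<rho> r)"
  let ?s = "\<lambda>r c. entry_sign fs (?\<kappa> c) (?\<rho> r) :: 'k"
  note carrier = submatrix_carrier[OF I J] and entry = submatrix_entry[OF I J]
  have coeff: "Poly_Mapping.lookup (det (submatrix M I J)) \<mu> \<noteq> 0"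
      "Poly_Mapping.lookup (det (submatrix M I J)) \<nu> \<noteq> 0"
    using binom neq unfolding q by (auto simp: lookup_add lookup_minus lookup_single when_def)
  obtain \<sigma> where \<sigma>: "\<sigma> permutes {0..<t}" "\<mu> = var_exp (\<lambda>c. ?h (\<sigma> c) c) t"
      "\<And>c. c < t \<Longrightarrow> ?s (\<sigma> c) c \<noteq> 0"
    using det_monomial_matrix_coeff[of "submatrix M I J" t ?h ?s, OF carrier entry coeff(1)] by blast
  obtain \<tau> where \<tau>: "\<tau> permutes {0..<t}" "\<nu> = var_exp (\<lambda>c. ?h (\<tau> c) c) t"
      "\<And>c. c < t \<Longrightarrow> ?s (\<tau> c) c \<noteq> 0"
    using det_monomial_matrix_coeff[of "submatrix M I J" t ?h ?s, OF carrier entry coeff(2)] by blast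
  define f where "f c = ?h (\<sigma> c) c" for c
  define g where "g c = ?h (\<tau> c) c" for c
  have \<mu>: "\<mu> = var_exp f t" and \<nu>: "\<nu> = var_exp g t" using \<sigma>(2) \<tau>(2) by (simp_all add: f_def[abs_def] g_def[abs_def])
  \<comment> \<open>For \<open>t = 0\<close> both monomials would be the empty product, contrary to
    \<open>\<mu> \<noteq> \<nu>\<close>.\<close>
  have "t > 0" using neq \<mu> \<nu> by (cases t) (auto simp: var_exp_def)
  have inj: "inj_on f {..<t}" "inj_on g {..<t}" using sqf unfolding \<mu> \<nu> squarefree_var_exp_iff by auto
  have disj: "f ` {..<t} \<inter> g ` {..<t} = {}" using cop unfolding \<mu> \<nu> coprime_exp_def keys_var_exp .
  have edges: "?\<kappa> c = (f c, g c) \<or> ?\<kappa> c = (g c, f c)"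
      "fs ! g c - fs ! f c = {?\<rho> (\<sigma> c)}" "fs ! f c - fs ! g c = {?\<rho> (\<tau> c)}" if c: "c < t" for c
  proof -
    have "f c \<noteq> g c" using disj c by auto
    then show "?\<kappa> c = (f c, g c) \<or> ?\<kappa> c = (g c, f c)"
      "fs ! g c - fs ! f c = {?\<rho> (\<sigma> c)}" "fs ! f c - fs ! g c = {?\<rho> (\<tau> c)}"
      using two_edges_of_entries[OF \<sigma>(3)[OF c] \<tau>(3)[OF c]] unfolding f_def g_def by blast+
  qed
  have "?\<kappa> c \<in> pair_indices (length fs)" if "c < t" for c
    using prs pick_lt(2)[OF I J that] nth_mem by (fastforce simp: enumerates_def)
  then have lt: "f c < length fs" "g c < length fs" if "c < t" for c
    using edges(1)[OF that] that by (fastforce simp: pair_indices_def)+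
  interpret two_entry_columns t \<sigma> \<tau> f g "\<lambda>c. ?s (\<tau> c) c" "submatrix M I J"
    by (rule two_entry_columns_submatrix[OF I J \<sigma>(1) \<tau>(1) edges inj disj])
  have irred: "C = {} \<or> C = {0..<t}" if "C \<subseteq> {0..<t}" "\<sigma> ` C = \<tau> ` C" for C
    using binom that unfolding q by (rule binomial_imp_irreducible)
  have det: "q = mono_poly \<mu> - mono_poly \<nu> \<or> q = - (mono_poly \<mu> - mono_poly \<nu>)"
    unfolding q \<mu> \<nu> using \<open>t > 0\<close> irred by (rule det_irreducible)
  from N(2) show ?thesis
  proof
    assume "mono_poly \<mu> = (\<Prod>e\<in>N. T_of fs e :: (nat, 'k) mpoly)"
    then obtain p where "pre_digraph.cycle (with_proj D) p" "length p = t"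
      "cycle_binomial fs p = (mono_poly \<mu> - mono_poly \<nu> :: (nat, 'k) mpoly)"
      using matching_monomial_cycle[OF I J \<sigma>(1) \<tau>(1) \<open>t > 0\<close> irred lt edges(2,3) N(1)]
      unfolding \<mu> \<nu> by blast
    then show ?thesis using det by auto
  \<comment> \<open>If \<open>\<nu>\<close> is the matching monomial, the roles of
    \<open>\<sigma>\<close> and \<open>\<tau>\<close> are exchanged, which changes the binomial only
    by its sign.\<close>
  next
    assume "mono_poly \<nu> = (\<Prod>e\<in>N. T_of fs e :: (nat, 'k) mpoly)"
    moreover have "C = {} \<or> C = {0..<t}" if "C \<subseteq> {0..<t}" "\<tau> ` C = \<sigma> ` C" for C
      using irred that by metis
    ultimately obtain p where "pre_digraph.cycle (with_proj D) p" "length p = t"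
      "cycle_binomial fs p = (mono_poly \<nu> - mono_poly \<mu> :: (nat, 'k) mpoly)"
      using matching_monomial_cycle[OF I J \<tau>(1) \<sigma>(1) \<open>t > 0\<close> _ lt(2,1) edges(3,2) N(1)]
      unfolding \<mu> \<nu> by blast
    then show ?thesis using det by auto
  qed
qed

end

section \<open>From directed cycles to binomial minors\<close>

text \<open>The columns are the paths from \<open>Y (a i)\<close> over \<open>X (a i)\<close> to the
  \<open>Y\<close> vertex of the next vertex of the cycle, and the rows are all the
  \<open>Y (a i)\<close>. Up to reordering this is a cyclic bidiagonal matrix.\<close>

lemma (in bip_jacobian_dual) cycle_imp_cycle_minor:
  assumes "pre_digraph.cycle (with_proj D) p"
  shows "\<exists>q. cycle_minor D fs prs M (length p) q \<and>
    (q = cycle_binomial fs p \<or> q = - cycle_binomial fs p)"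
proof -
  interpret pair_digraph D by (rule D)
  define t where "t = length p"
  obtain a where p: "p = map (\<lambda>i. (a i, a (Suc i))) [0..<t]" and closed: "a t = a 0"
    and inj_a: "inj_on a {..<t}" and arcs: "set p \<subseteq> parcs D" and "p \<noteq> []"
    using assms unfolding cycle_iff[OF D] t_def by auto
  then have t: "t > 0" by (simp add: t_def)
  \<comment> \<open>The cyclic successor on positions, so that all indices stay below
    \<open>t\<close>.\<close>
  define nxt where "nxt i = (if Suc i = t then 0 else Suc i)" for i
  have a_nxt: "a (nxt i) = a (Suc i)" for i using closed by (auto simp: nxt_def)
  have nxt_lt: "nxt i < t" if "i < t" for i using that by (auto simp: nxt_def)
  have arc: "(a i, a (nxt i)) \<in> parcs D" if "i < t" for i
    using arcs that unfolding p a_nxt by auto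
  have a_vert: "a i \<in> pverts D" if "i < t" for i using arc[OF that] in_arcsD1 by blast
  have a_neq: "a i \<noteq> a (nxt i)" if "i < t" for i using pair_no_loops[OF arc[OF that]] by simp

  define m where "m i = {X (a i), Y (a i)}" for i
  define g where "g i = {X (a i), Y (a (nxt i))}" for i
  have m_matching: "m i \<in> bip_matching D" if "i < t" for i
    using a_vert[OF that] by (auto simp: m_def bip_matching_def)
  have m_edge: "m i \<in> bip_edges D" if "i < t" for i using m_matching[OF that] matching_subset_edges by auto
  have g_edge: "g i \<in> bip_edges D" if "i < t" for i
    using a_neq[OF that] arc[OF that] by (auto simp: g_def bip_edges_def)
  note index_m = edge_index[OF m_edge] and index_g = edge_index[OF g_edge]
  have index_eq_iff: "edge_index e = edge_index e' \<longleftrightarrow> e = e'" if "e \<in> bip_edges D" "e' \<in> bip_edges D" for e e'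
    using edge_index(2) that by metis
  have m_neq_g: "m i \<noteq> g j" if "i < t" "j < t" for i j
    using a_neq[OF that(2)] by (auto simp: m_def g_def doubleton_eq_iff)
  have inj_m: "inj_on m {..<t}" and inj_g: "inj_on g {..<t}"
    using inj_a by (auto simp: m_def g_def inj_on_def doubleton_eq_iff)

  \<comment> \<open>\<open>prs\<close> lists only pairs with increasing components, hence the
    minimum and maximum.\<close>
  define pr where "pr i = (min (edge_index (m i)) (edge_index (g i)), max (edge_index (m i)) (edge_index (g i)))" for i
  have pr: "pr i = (edge_index (m i), edge_index (g i)) \<or> pr i = (edge_index (g i), edge_index (m i))" for i
    by (auto simp: pr_def min_def max_def)
  have "pr i \<in> pair_indices (length fs)" if "i < t" for i
    using index_m(1)[OF that] index_g(1)[OF that] m_neq_g[OF that that]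
      index_eq_iff[OF m_edge g_edge, OF that that]
    by (auto simp: pr_def pair_indices_def)
  then have "\<exists>c<length prs. prs ! c = pr i" if "i < t" for i
    using prs that by (metis enumerates_def in_set_conv_nth)
  then obtain cl where cl: "\<And>i. i < t \<Longrightarrow> cl i < length prs" "\<And>i. i < t \<Longrightarrow> prs ! cl i = pr i"
    by metis
  have center: "path_center fs (prs ! cl i) = X (a i)" if "i < t" for i
  proof -
    have "m i \<inter> g i = {X (a i)}" "g i \<inter> m i = {X (a i)}"
      using a_neq[OF that] by (auto simp: m_def g_def)
    then show ?thesis
      using pr[of i] index_m(2)[OF that] index_g(2)[OF that] cl(2)[OF that]
      by (auto simp: path_center_def simp del: Int_iff)
  qed
  have inj_cl: "inj_on cl {..<t}"
  proof (rule inj_onI)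
    fix i j assume "i \<in> {..<t}" "j \<in> {..<t}" "cl i = cl j"
    then have "a i = a j" using center[of i] center[of j] by simp
    then show "i = j" using inj_a \<open>i \<in> _\<close> \<open>j \<in> _\<close> by (auto dest: inj_onD)
  qed
  have "\<exists>r<length vs. vs ! r = Y (a i)" if "i < t" for i
    using set_vs a_vert[OF that] by (metis UnI2 image_eqI in_set_conv_nth)
  then obtain rw where rw: "\<And>i. i < t \<Longrightarrow> rw i < length vs" "\<And>i. i < t \<Longrightarrow> vs ! rw i = Y (a i)"
    by metis
  have inj_rw: "inj_on rw {..<t}"
  proof (rule inj_onI)
    fix i j assume "i \<in> {..<t}" "j \<in> {..<t}" "rw i = rw j"
    then have "a i = a j" using rw(2)[of i] rw(2)[of j] by simp
    then show "i = j" using inj_a \<open>i \<in> _\<close> \<open>j \<in> _\<close> by (auto dest: inj_onD)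
  qed

  define I where "I = rw ` {..<t}"
  define J where "J = cl ` {..<t}"
  have I: "I \<subseteq> {..<dim_row M}" "card I = t" and J: "J \<subseteq> {..<dim_col M}" "card J = t"
    using rw(1) cl(1) inj_rw inj_cl by (auto simp: I_def J_def dims card_image)
  \<comment> \<open>A submatrix numbers its rows and columns increasingly, not along the cycle.
    \<open>\<alpha> c\<close> is the cycle position of its column \<open>c\<close>, and
    \<open>\<beta> i\<close> is the number of the row of \<open>Y (a i)\<close>.\<close>
  define \<alpha> where "\<alpha> = inv_into {..<t} cl \<circ> pick J"
  define \<beta> where "\<beta> = inv_into {..<t} (inv_into {..<t} rw \<circ> pick I)"
  have bij_\<alpha>: "bij_betw \<alpha> {..<t} {..<t}"
    unfolding \<alpha>_def using bij_betw_pick_cols[OF I J] inj_cl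
    by (intro bij_betw_trans[of _ _ J] bij_betw_inv_into) (auto simp: J_def bij_betw_def)
  have bij_r: "bij_betw (inv_into {..<t} rw \<circ> pick I) {..<t} {..<t}"
    using bij_betw_pick_rows[OF I J] inj_rw
    by (intro bij_betw_trans[of _ _ I] bij_betw_inv_into) (auto simp: I_def bij_betw_def)
  then have bij_\<beta>: "bij_betw \<beta> {..<t} {..<t}" unfolding \<beta>_def by (rule bij_betw_inv_into)
  have \<alpha>_lt: "\<alpha> c < t" and \<beta>_lt: "\<beta> c < t" if "c < t" for c
    using bij_betwE[OF bij_\<alpha>] bij_betwE[OF bij_\<beta>] that by auto
  have pick_J: "prs ! pick J c = pr (\<alpha> c)" if "c < t" for c
  proof -
    have "pick J c \<in> cl ` {..<t}" using bij_betwE[OF bij_betw_pick_cols[OF I J]] that by (auto simp: J_def)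
    then have "cl (\<alpha> c) = pick J c" unfolding \<alpha>_def by (simp add: f_inv_into_f)
    then show ?thesis using cl(2)[OF \<alpha>_lt[OF that]] by simp
  qed
  have pick_I: "vs ! pick I (\<beta> i) = Y (a i)" if "i < t" for i
  proof -
    have "(inv_into {..<t} rw \<circ> pick I) (\<beta> i) = i"
      unfolding \<beta>_def using that by (intro bij_betw_inv_into_right[OF bij_r]) simp
    moreover have "pick I (\<beta> i) \<in> rw ` {..<t}"
      using bij_betwE[OF bij_betw_pick_rows[OF I J]] \<beta>_lt[OF that] by (auto simp: I_def)
    ultimately have "rw i = pick I (\<beta> i)" by (metis comp_apply f_inv_into_f)
    then show ?thesis using rw(2)[OF that] by simp
  qed

  have "inj_on nxt {..<t}" by (auto simp: nxt_def inj_on_def split: if_splits)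
  moreover have "nxt ` {..<t} \<subseteq> {..<t}" using nxt_lt by auto
  ultimately have bij_nxt: "bij_betw nxt {..<t} {..<t}"
    by (simp add: bij_betw_def endo_inj_surj)
  \<comment> \<open>In the column of position \<open>i\<close>, \<open>\<sigma>\<close> picks the
    row of the next vertex, which carries the matching variable, and \<open>\<tau>\<close> the row
    of \<open>Y (a i)\<close>. Outside the index range both are the identity, as
    \<open>permutes\<close> demands.\<close>
  define \<sigma> where "\<sigma> c = (if c < t then \<beta> (nxt (\<alpha> c)) else c)" for c
  define \<tau> where "\<tau> c = (if c < t then \<beta> (\<alpha> c) else c)" for c
  have "bij_betw (\<beta> \<circ> (nxt \<circ> \<alpha>)) {..<t} {..<t}" "bij_betw (\<beta> \<circ> \<alpha>) {..<t} {..<t}"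
    using bij_\<alpha> bij_\<beta> bij_nxt by (blast intro: bij_betw_trans)+
  moreover have "bij_betw \<sigma> {..<t} {..<t} \<longleftrightarrow> bij_betw (\<beta> \<circ> (nxt \<circ> \<alpha>)) {..<t} {..<t}"
      "bij_betw \<tau> {..<t} {..<t} \<longleftrightarrow> bij_betw (\<beta> \<circ> \<alpha>) {..<t} {..<t}"
    by (rule bij_betw_cong; simp add: \<sigma>_def \<tau>_def)+
  ultimately have \<sigma>: "\<sigma> permutes {0..<t}" and \<tau>: "\<tau> permutes {0..<t}"
    by (auto intro!: bij_imp_permutes simp: \<sigma>_def \<tau>_def atLeast0LessThan split: if_splits)
  define f' where "f' c = edge_index (m (\<alpha> c))" for c
  define g' where "g' c = edge_index (g (\<alpha> c))" for c
  have pair: "prs ! pick J c = (f' c, g' c) \<or> prs ! pick J c = (g' c, f' c)" if "c < t" for c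
    using pick_J[OF that] pr[of "\<alpha> c"] by (simp add: f'_def g'_def)
  have diff: "fs ! g' c - fs ! f' c = {vs ! pick I (\<sigma> c)}" "fs ! f' c - fs ! g' c = {vs ! pick I (\<tau> c)}"
    if "c < t" for c
  proof -
    have "fs ! g' c = g (\<alpha> c)" "fs ! f' c = m (\<alpha> c)"
      using index_m(2)[OF \<alpha>_lt[OF that]] index_g(2)[OF \<alpha>_lt[OF that]] by (simp_all add: f'_def g'_def)
    moreover have "vs ! pick I (\<sigma> c) = Y (a (nxt (\<alpha> c)))" "vs ! pick I (\<tau> c) = Y (a (\<alpha> c))"
      using that by (simp_all add: \<sigma>_def \<tau>_def pick_I \<alpha>_lt nxt_lt)
    ultimately show "fs ! g' c - fs ! f' c = {vs ! pick I (\<sigma> c)}" "fs ! f' c - fs ! g' c = {vs ! pick I (\<tau> c)}"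
      using a_neq[OF \<alpha>_lt[OF that]] by (auto simp: m_def g_def)
  qed
  have inj_\<alpha>: "inj_on \<alpha> {..<t}" and img_\<alpha>: "\<alpha> ` {..<t} = {..<t}"
    using bij_\<alpha> by (auto simp: bij_betw_def)
  have inj: "inj_on f' {..<t}" "inj_on g' {..<t}"
    using inj_\<alpha> inj_m inj_g \<alpha>_lt m_edge g_edge
    by (auto simp: f'_def g'_def inj_on_def index_eq_iff)
  have disj: "f' ` {..<t} \<inter> g' ` {..<t} = {}"
    using m_neq_g \<alpha>_lt m_edge g_edge by (auto simp: f'_def g'_def index_eq_iff)
  interpret two_entry_columns t \<sigma> \<tau> f' g' "\<lambda>c. entry_sign fs (prs ! pick J c) (vs ! pick I (\<tau> c)) :: 'k"
    "submatrix M I J"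
    by (rule two_entry_columns_submatrix[OF I J \<sigma> \<tau> pair diff inj disj])

  have irred: "C = {} \<or> C = {0..<t}" if C: "C \<subseteq> {0..<t}" "\<sigma> ` C = \<tau> ` C" for C
  proof (cases "C = {}")
    case False
    \<comment> \<open>Translated to cycle positions, invariance of \<open>C\<close> says that
      \<open>nxt\<close> preserves \<open>E\<close>.\<close>
    define E where "E = \<alpha> ` C"
    have E: "E \<subseteq> {..<t}" "E \<noteq> {}" using C(1) \<alpha>_lt False by (auto simp: E_def)
    have "\<sigma> ` C = \<beta> ` (nxt ` E)" "\<tau> ` C = \<beta> ` E"
      using C(1) by (auto simp: \<sigma>_def \<tau>_def E_def image_image subset_eq intro!: image_cong)
    moreover have "nxt ` E \<subseteq> {..<t}" using E(1) nxt_lt by auto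
    ultimately have nxt_E: "nxt ` E = E"
      using C(2) bij_\<beta> E(1) inj_on_image_eq_iff[of \<beta> "{..<t}" "nxt ` E" E] by (simp add: bij_betw_def)
    \<comment> \<open>Below the last position \<open>nxt\<close> is the successor, so
      \<open>E\<close> is closed upwards; the wrap at \<open>t - 1\<close> then brings in 0 and with
      it everything.\<close>
    have up: "i + n \<in> E" if "i \<in> E" "i + n < t" for i n
      using that
    proof (induction n)
      case (Suc n)
      then have "nxt (i + n) \<in> E" using nxt_E by auto
      then show ?case using Suc.prems by (simp add: nxt_def)
    qed simp
    obtain i where i: "i \<in> E" using E(2) by blast
    then have "t - 1 \<in> E" using up[of i "t - 1 - i"] E(1) t by auto
    then have "nxt (t - 1) \<in> E" using nxt_E by blast
    then have "0 \<in> E" using t by (simp add: nxt_def)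
    then have "{..<t} \<subseteq> E" using up[of 0] by auto
    then have "\<alpha> ` C = \<alpha> ` {..<t}" using E(1) img_\<alpha> by (auto simp: E_def)
    then have "C = {..<t}" using inj_\<alpha> C(1) by (metis atLeast0LessThan inj_on_image_eq_iff order_refl)
    then show ?thesis by (simp add: atLeast0LessThan)
  qed simp

  define q where "q = det (submatrix M I J)"
  let ?F = "var_exp f' t" and ?G = "var_exp g' t"
  have det: "q = mono_poly ?F - mono_poly ?G \<or> q = mono_poly ?G - mono_poly ?F"
    using det_irreducible[OF t irred] by (auto simp: q_def)
  have reindex: "(\<Prod>i<t. T_of fs (h i)) = (mono_poly (var_exp (\<lambda>c. edge_index (h (\<alpha> c))) t) :: (nat, 'k) mpoly)" for h
    unfolding mono_poly_var_exp T_of_eq using bij_\<alpha>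
    by (rule prod.reindex_bij_betw[symmetric])
  have list_prod: "(\<Prod>(z, w)\<leftarrow>p. H z w) = (\<Prod>i<t. H (a i) (a (nxt i)))" for H :: "'a \<Rightarrow> 'a \<Rightarrow> (nat, 'k) mpoly"
    using prod.distinct_set_conv_list[of "[0..<t]" "\<lambda>i. H (a i) (a (Suc i))"]
    by (simp add: p o_def a_nxt atLeast0LessThan)
  have prod_m: "(\<Prod>i<t. T_of fs (m i)) = (mono_poly ?F :: (nat, 'k) mpoly)"
    unfolding reindex by (simp add: f'_def[abs_def])
  have prod_g: "(\<Prod>i<t. T_of fs (g i)) = (mono_poly ?G :: (nat, 'k) mpoly)"
    unfolding reindex by (simp add: g'_def[abs_def])
  have cb: "cycle_binomial fs p = (mono_poly ?F - mono_poly ?G :: (nat, 'k) mpoly)"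
    unfolding cycle_binomial_def list_prod prod_m[symmetric] prod_g[symmetric]
    by (simp add: m_def g_def)
  have "cycle_minor D fs prs M t q"
    unfolding cycle_minor_def
  proof (rule exI[of _ I], rule exI[of _ J], intro conjI)
    \<comment> \<open>The entry in the row of \<open>Y (a i)\<close> is a variable up to
      sign.\<close>
    have nonzero: "col M (cl i) \<noteq> 0\<^sub>v (dim_row M)" if i: "i < t" for i
    proof
      assume "col M (cl i) = 0\<^sub>v (dim_row M)"
      then have "M $$ (rw i, cl i) = 0"
        using rw(1)[OF i] cl(1)[OF i] dims by (metis index_col index_zero_vec(1))
      moreover have "entry_sign fs (pr i) (Y (a i)) \<noteq> (0 :: 'k)"
      proof -
        have "fs ! edge_index (g i) - fs ! edge_index (m i) = {Y (a (nxt i))}"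
          "fs ! edge_index (m i) - fs ! edge_index (g i) = {Y (a i)}"
          unfolding index_m(2)[OF i] index_g(2)[OF i] using a_neq[OF i] by (auto simp: m_def g_def)
        from entry_of_two_edges(4)[OF pr this, where 'k = 'k] show ?thesis by auto
      qed
      ultimately show False
        using entry[OF rw(1)[OF i] cl(1)[OF i]] unfolding rw(2)[OF i] cl(2)[OF i]
        by (metis lookup_single_eq lookup_zero)
    qed
    show "pairwise (center_distinct fs prs M) J"
    proof (rule pairwiseI)
      fix c d assume "c \<in> J" "d \<in> J" "c \<noteq> d"
      then obtain i j where ij: "i < t" "j < t" "c = cl i" "d = cl j" by (auto simp: J_def)
      then have "i \<noteq> j" using \<open>c \<noteq> d\<close> by auto
      then have "a i \<noteq> a j" using inj_a ij by (auto dest: inj_onD)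
      then show "center_distinct fs prs M c d"
        unfolding center_distinct_def ij using nonzero ij center by simp
    qed
    have FG: "?F \<noteq> ?G"
    proof
      assume "?F = ?G"
      then have "f' ` {..<t} = g' ` {..<t}" by (metis keys_var_exp)
      then show False using disj t by auto
    qed
    have sqf: "squarefree_exp ?F" "squarefree_exp ?G" using inj by (auto simp: squarefree_var_exp_iff)
    have cop: "coprime_exp ?F ?G" "coprime_exp ?G ?F"
      using disj by (auto simp: coprime_exp_def keys_var_exp)
    have N: "m ` {..<t} \<subseteq> bip_matching D"
      "mono_poly ?F = (\<Prod>e\<in>m ` {..<t}. T_of fs e :: (nat, 'k) mpoly)"
      using m_matching prod_m by (auto simp: prod.reindex[OF inj_m])
    \<comment> \<open>The sign of the minor decides which monomial is called \<open>\<mu>\<close>;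
      the matching condition allows either of the two.\<close>
    from det show "\<exists>\<mu> \<nu>. \<mu> \<noteq> \<nu> \<and>
        (q = mono_poly \<mu> + mono_poly \<nu> \<or> q = mono_poly \<mu> - mono_poly \<nu>) \<and>
        squarefree_exp \<mu> \<and> squarefree_exp \<nu> \<and> coprime_exp \<mu> \<nu> \<and>
        (\<exists>N\<subseteq>bip_matching D. mono_poly \<mu> = (\<Prod>e\<in>N. T_of fs e :: (nat, 'k) mpoly) \<or>
          mono_poly \<nu> = (\<Prod>e\<in>N. T_of fs e :: (nat, 'k) mpoly))"
    proof
      assume "q = mono_poly ?F - mono_poly ?G"
      then show ?thesis using FG sqf cop N by blast
    next
      assume "q = mono_poly ?G - mono_poly ?F"
      then show ?thesis using FG sqf cop N by metis
    qed
  qed (use I J q_def in auto)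
  then show ?thesis using det cb unfolding t_def by (intro exI[of _ q]) auto
qed

theorem corollary4p3:
  fixes D :: "'a pair_pre_digraph"
    and zs :: "'a list"
    and fs :: "'a bvert set list"
    and prs :: "(nat \<times> nat) list"
    and B :: "(nat, ('a bvert, 'k::field) mpoly) mpoly mat"
    and t :: nat
  assumes "infinite (UNIV :: 'k set)"
    and "pair_digraph D"
    and "enumerates zs (pverts D)"
    and "enumerates fs (bip_edges D)"
    and "enumerates prs (pair_indices (length fs))"
    and "jacobian_dual (bip_vars zs) (taylor_matrix fs prs) B"
  shows
    "(\<forall>p. pre_digraph.cycle (with_proj D) p \<and> length p = t \<longrightarrow>
        (\<exists>q. cycle_minor D fs prs (reduce_mod_vars B) t q \<and>
          (q = cycle_binomial fs p \<or> q = - cycle_binomial fs p))) \<and>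
     (\<forall>q. cycle_minor D fs prs (reduce_mod_vars B) t q \<longrightarrow>
        (\<exists>p. pre_digraph.cycle (with_proj D) p \<and> length p = t \<and>
          (q = cycle_binomial fs p \<or> q = - cycle_binomial fs p)))"
proof -
  interpret bip_jacobian_dual D zs fs prs B using assms(2-6) by (rule bip_jacobian_dual.intro)
  show ?thesis using cycle_imp_cycle_minor cycle_minor_imp_cycle by blast
qed

end
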